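(* Let $p>0$ be real and $\rho\geq 1$. If there is a polynomial-time algorithm that, for every graph, finds an independent set of size at least $\alpha/\rho$, where $\alpha$ is the independence number of the graph, then there is a polynomial-time algorithm for the maximum $p$-mean graph coloring problem that outputs a proper coloring whose value is at least $\mathrm{OPT}/\left(\rho(p+1)^{1/p}\right)$.
   Context: Given a simple undirected graph $G=(V,E)$ with $n$ vertices, a proper coloring is a map $\phi:V\to\mathbb N$ with $\phi(u)\neq\phi(v)$ for every edge $uv$. For $v\in V$ let $a_v:=|\phi^{-1}(\phi(v))|$. The maximum $p$-mean graph coloring problem asks for a proper coloring maximizing $M_p(\{a_v:v\in V\})=\left(\frac1n\sum_{v\in V}a_v^p\right)^{1/p}$; $\mathrm{OPT}$ is the maximum. *)

theory Defs
  imports Complex_Main "HOL-Library.FuncSet" "HOL-Computational_Algebra.Polynomial"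
begin

subsection \<open>Graphs, independent sets, colorings\<close>

type_synonym 'a graph = "'a set \<times> 'a set set"

abbreviation verts :: "'a graph \<Rightarrow> 'a set" where "verts \<equiv> fst"
abbreviation edges :: "'a graph \<Rightarrow> 'a set set" where "edges \<equiv> snd"

definition simple_graph :: "'a graph \<Rightarrow> bool" where
  "simple_graph G \<longleftrightarrow> finite (verts G) \<and> (\<forall>e\<in>edges G. e \<subseteq> verts G \<and> card e = 2)"

definition independent_set :: "'a graph \<Rightarrow> 'a set \<Rightarrow> bool" where
  "independent_set G S \<longleftrightarrow> S \<subseteq> verts G \<and> (\<forall>u\<in>S. \<forall>v\<in>S. {u, v} \<notin> edges G)"

definition independence_number :: "'a graph \<Rightarrow> nat" where
  "independence_number G = Max {card S |S. independent_set G S}"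

definition proper_coloring :: "'a graph \<Rightarrow> ('a \<Rightarrow> nat) \<Rightarrow> bool" where
  "proper_coloring G \<phi> \<longleftrightarrow> (\<forall>u v. {u, v} \<in> edges G \<longrightarrow> \<phi> u \<noteq> \<phi> v)"

definition color_class_size :: "'a graph \<Rightarrow> ('a \<Rightarrow> nat) \<Rightarrow> 'a \<Rightarrow> nat" where
  "color_class_size G \<phi> v = card {u \<in> verts G. \<phi> u = \<phi> v}"

text \<open>For the empty index set the division by zero makes the \<open>p\<close>-mean \<open>0\<close>.\<close>

definition p_mean :: "real \<Rightarrow> 'a set \<Rightarrow> ('a \<Rightarrow> real) \<Rightarrow> real" where
  "p_mean p V a = (1 / real (card V) * (\<Sum>v\<in>V. a v powr p)) powr (1 / p)"

definition coloring_value :: "real \<Rightarrow> 'a graph \<Rightarrow> ('a \<Rightarrow> nat) \<Rightarrow> real" where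
  "coloring_value p G \<phi> = p_mean p (verts G) (\<lambda>v. real (color_class_size G \<phi> v))"

definition OPT :: "real \<Rightarrow> 'a graph \<Rightarrow> real" where
  "OPT p G = Max {coloring_value p G \<phi> |\<phi>. proper_coloring G \<phi>}"

text \<open>The two maxima are taken over finite nonempty sets.\<close>

lemma independent_set_sizes_finite_nonempty:
  assumes "simple_graph G"
  shows "finite {card S |S. independent_set G S}" "{card S |S. independent_set G S} \<noteq> {}"
proof -
  have "{card S |S. independent_set G S} \<subseteq> card ` Pow (verts G)"
    by (auto simp: independent_set_def)
  then show "finite {card S |S. independent_set G S}"
    using assms by (meson finite_Pow_iff finite_imageI finite_subset simple_graph_def)
  have "independent_set G {}"
    by (simp add: independent_set_def)
  then show "{card S |S. independent_set G S} \<noteq> {}"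
    by blast
qed

lemma coloring_values_finite_nonempty:
  assumes G: "simple_graph G"
  shows "finite {coloring_value p G \<phi> |\<phi>. proper_coloring G \<phi>}"
    "{coloring_value p G \<phi> |\<phi>. proper_coloring G \<phi>} \<noteq> {}"
proof -
  let ?n = "card (verts G)"
  have fin: "finite (verts G)"
    using G by (simp add: simple_graph_def)
  have "coloring_value p G \<phi> \<in> (\<lambda>a. p_mean p (verts G) (\<lambda>v. real (a v))) ` (verts G \<rightarrow>\<^sub>E {..?n})"
    for \<phi>
  proof
    show "restrict (color_class_size G \<phi>) (verts G) \<in> verts G \<rightarrow>\<^sub>E {..?n}"
      using fin by (auto simp: color_class_size_def intro: card_mono)
    show "coloring_value p G \<phi>
        = p_mean p (verts G) (\<lambda>v. real (restrict (color_class_size G \<phi>) (verts G) v))"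
      by (simp add: coloring_value_def p_mean_def)
  qed
  then have "{coloring_value p G \<phi> |\<phi>. proper_coloring G \<phi>}
      \<subseteq> (\<lambda>a. p_mean p (verts G) (\<lambda>v. real (a v))) ` (verts G \<rightarrow>\<^sub>E {..?n})"
    by blast
  then show "finite {coloring_value p G \<phi> |\<phi>. proper_coloring G \<phi>}"
    using fin by (meson finite_PiE finite_atMost finite_imageI finite_subset)
  obtain f :: "'a \<Rightarrow> nat" where f: "inj_on f (verts G)"
    using fin finite_imp_inj_to_nat_seg by blast
  have "proper_coloring G f"
    unfolding proper_coloring_def
  proof (intro allI impI notI)
    fix u v assume e: "{u, v} \<in> edges G" and eq: "f u = f v"
    then have "{u, v} \<subseteq> verts G" "card {u, v} = 2"
      using G by (auto simp: simple_graph_def)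
    moreover from this have "u = v"
      using f eq by (auto dest: inj_onD)
    ultimately show False
      by simp
  qed
  then show "{coloring_value p G \<phi> |\<phi>. proper_coloring G \<phi>} \<noteq> {}"
    by blast
qed


subsection \<open>Polynomial-time algorithms\<close>

text \<open>
  Algorithms are structured programs over finitely many registers, each holding a stack of bits.
  Every instruction inspects or changes only the top of one stack and takes one time step. This
  is a multi-tape Turing machine with structured control (a tape is a pair of stacks and
  conversely a stack is a tape whose head is at the top, with constant overhead per step), so
  polynomial time has its usual meaning.
\<close>

datatype com =
    Skip
  | Push nat bool
  | Pop nat
  | Seq com com
  | Case nat com com com \<comment> \<open>branches: stack empty, top bit False, top bit True\<close>
  | While nat com \<comment> \<open>repeat as long as the stack is nonempty\<close>

type_synonym state = "nat \<Rightarrow> bool list"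

text \<open>\<open>exec c s t s'\<close>: started in \<open>s\<close>, \<open>c\<close> halts after exactly \<open>t\<close> steps in \<open>s'\<close>.
  Popping an empty stack has no effect.\<close>

inductive exec :: "com \<Rightarrow> state \<Rightarrow> nat \<Rightarrow> state \<Rightarrow> bool" where
  Skip: "exec Skip s 1 s"
| Push: "exec (Push r b) s 1 (s(r := b # s r))"
| Pop: "exec (Pop r) s 1 (s(r := tl (s r)))"
| Seq: "exec c1 s t1 s' \<Longrightarrow> exec c2 s' t2 s'' \<Longrightarrow> exec (Seq c1 c2) s (t1 + t2) s''"
| Case_Empty: "s r = [] \<Longrightarrow> exec c0 s t s' \<Longrightarrow> exec (Case r c0 c1 c2) s (1 + t) s'"
| Case_False: "s r = False # w \<Longrightarrow> exec c1 s t s' \<Longrightarrow> exec (Case r c0 c1 c2) s (1 + t) s'"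
| Case_True: "s r = True # w \<Longrightarrow> exec c2 s t s' \<Longrightarrow> exec (Case r c0 c1 c2) s (1 + t) s'"
| While_Empty: "s r = [] \<Longrightarrow> exec (While r c) s 1 s"
| While_Nonempty: "s r \<noteq> [] \<Longrightarrow> exec c s t1 s' \<Longrightarrow> exec (While r c) s' t2 s'' \<Longrightarrow>
    exec (While r c) s (1 + t1 + t2) s''"

inductive_cases exec_elims:
  "exec Skip s t s'" "exec (Push r b) s t s'" "exec (Pop r) s t s'" "exec (Seq c1 c2) s t s'"
  "exec (Case r c0 c1 c2) s t s'" "exec (While r c) s t s'"

lemma exec_deterministic:
  "exec c s t s' \<Longrightarrow> exec c s u s'' \<Longrightarrow> u = t \<and> s'' = s'"
proof (induction arbitrary: u s'' rule: exec.induct)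
  case (Seq c1 s t1 s1 c2 t2 s2)
  from Seq.prems obtain u1 u2 r1 where "exec c1 s u1 r1" "exec c2 r1 u2 s''" "u = u1 + u2"
    by (rule exec_elims(4))
  with Seq.IH show ?case
    by metis
next
  case (While_Nonempty s r c t1 s1 t2 s2)
  from While_Nonempty.prems While_Nonempty.hyps(1)
  obtain u1 u2 r1 where "exec c s u1 r1" "exec (While r c) r1 u2 s''" "u = 1 + u1 + u2"
    by (auto elim: exec_elims(6))
  with While_Nonempty.IH show ?case
    by metis
next
  case (While_Empty s r c)
  then show ?case
    by (auto elim: exec_elims(6))
next
  case (Case_Empty s r c0 t s' c1 c2)
  from Case_Empty.prems Case_Empty.hyps(1) obtain u1 where "exec c0 s u1 s''" "u = 1 + u1"
    by (auto elim: exec_elims(5))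
  with Case_Empty.IH show ?case
    by metis
next
  case (Case_False s r w c1 t s' c0 c2)
  from Case_False.prems Case_False.hyps(1) obtain u1 where "exec c1 s u1 s''" "u = 1 + u1"
    by (auto elim: exec_elims(5))
  with Case_False.IH show ?case
    by metis
next
  case (Case_True s r w c2 t s' c0 c1)
  from Case_True.prems Case_True.hyps(1) obtain u1 where "exec c2 s u1 s''" "u = 1 + u1"
    by (auto elim: exec_elims(5))
  with Case_True.IH show ?case
    by metis
qed (auto elim: exec_elims(1-3))

text \<open>Input and output are passed in register 0; all other registers are initially empty.\<close>

definition computes_in :: "com \<Rightarrow> bool list \<Rightarrow> nat \<Rightarrow> bool list \<Rightarrow> bool" where
  "computes_in c x t y \<longleftrightarrow>
    (\<exists>s. exec c (\<lambda>r. if r = 0 then x else []) t s \<and> s 0 = y)"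

text \<open>\<open>polynomial_time_algorithm I enc_in enc_out R c\<close>: on every instance \<open>i \<in> I\<close>, the program \<open>c\<close>
  outputs (the encoding of) some \<open>z\<close> with \<open>R i z\<close>, in time polynomial in the input length.\<close>

definition polynomial_time_algorithm ::
  "'i set \<Rightarrow> ('i \<Rightarrow> bool list) \<Rightarrow> ('i \<Rightarrow> 'o \<Rightarrow> bool list) \<Rightarrow> ('i \<Rightarrow> 'o \<Rightarrow> bool) \<Rightarrow> com \<Rightarrow> bool"
where
  "polynomial_time_algorithm I enc_in enc_out R c \<longleftrightarrow>
    (\<exists>q :: nat poly. \<forall>i\<in>I. \<exists>t z. R i z \<and>
       computes_in c (enc_in i) t (enc_out i z) \<and> t \<le> poly q (length (enc_in i)))"


subsection \<open>Encodings\<close>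

text \<open>Inputs are the graphs with vertex set \<open>{0,\<dots>,n-1}\<close>, which covers every finite graph up to
  renaming of vertices. A graph is given by \<open>n\<close> in unary, terminated by \<open>False\<close>, followed by its
  adjacency matrix row by row.\<close>

definition graph_instances :: "nat graph set" where
  "graph_instances = {G. simple_graph G \<and> (\<exists>n. verts G = {..<n})}"

definition encode_graph :: "nat graph \<Rightarrow> bool list" where
  "encode_graph G = (let n = card (verts G) in
     replicate n True @ [False] @
     concat (map (\<lambda>u. map (\<lambda>v. {u, v} \<in> edges G) [0..<n]) [0..<n]))"

definition encode_vertex_set :: "nat graph \<Rightarrow> nat set \<Rightarrow> bool list" where
  "encode_vertex_set G S = map (\<lambda>v. v \<in> S) [0..<card (verts G)]"

text \<open>The colors of the vertices \<open>0,\<dots>,n-1\<close> in this order, each in unary and terminated by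
  \<open>False\<close>.\<close>

definition encode_coloring :: "nat graph \<Rightarrow> (nat \<Rightarrow> nat) \<Rightarrow> bool list" where
  "encode_coloring G \<phi> =
     concat (map (\<lambda>v. replicate (\<phi> v) True @ [False]) [0..<card (verts G)])"

end

theory Submission
  imports Defs
begin

text \<open>
  Color greedily: repeatedly apply the given algorithm to the subgraph induced by the uncolored
  vertices and make its output a new color class. Let \<open>Y\<close> be a color class of an optimal coloring.
  When a class \<open>S\<close> is chosen while \<open>j\<close> vertices of \<open>Y\<close> are uncolored, \<open>card S \<ge> j / \<rho>\<close>; hence the
  sum of \<open>a\<^sub>v\<^sup>p\<close> over \<open>Y\<close> is at least the sum of \<open>(j / \<rho>)\<^sup>p\<close> over \<open>j = 1,\<dots>,card Y\<close>, which is at least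
  \<open>card Y\<^sup>p\<^sup>+\<^sup>1 / ((p + 1) \<rho>\<^sup>p)\<close>. Sum over all \<open>Y\<close> and take \<open>p\<close>-th roots.

  The program runs \<open>n\<close> rounds, the last of which may act on the empty graph. Instead of a
  color counter, each uncolored vertex carries its own provisional color.
\<close>

subsection \<open>Analysis of the greedy coloring\<close>

text \<open>The left side is the integral of \<open>x powr p\<close> over \<open>[0, m]\<close>, and
  the sum is an upper Riemann sum for it. The mean value theorem handles one unit interval per
  induction step.\<close>

lemma sum_powr_ge_integral:
  fixes p :: real
  assumes "p > 0"
  shows "real m powr (p + 1) / (p + 1) \<le> (\<Sum>j=1..m. real j powr p)"
proof (induction m)
  case (Suc m)
  have "real (Suc m) powr (p + 1) - real m powr (p + 1) \<le> (p + 1) * real (Suc m) powr p"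
  \<comment> \<open>The derivative rule for \<open>powr\<close> asks for a positive point; for
    \<open>m = 0\<close> the claim reads \<open>1 \<le> p + 1\<close>.\<close>
  proof (cases "m = 0")
    case False
    have "\<exists>z. real m < z \<and> z < real (Suc m) \<and>
        real (Suc m) powr (p + 1) - real m powr (p + 1)
          = (real (Suc m) - real m) * ((p + 1) * z powr p)"
    proof (rule MVT2)
      fix x assume "real m \<le> x" "x \<le> real (Suc m)"
      then show "((\<lambda>x. x powr (p + 1)) has_real_derivative (p + 1) * x powr p) (at x)"
        using False has_real_derivative_powr[of x "p + 1"] by simp
    qed simp
    then obtain z where z: "real m < z" "z < real (Suc m)"
      "real (Suc m) powr (p + 1) - real m powr (p + 1) = (p + 1) * z powr p"
      by auto
    then have "z powr p \<le> real (Suc m) powr p"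
      using assms by (intro powr_mono2) auto
    then show ?thesis
      using z assms by simp
  qed (use assms in simp)
  then have "real (Suc m) powr (p + 1) / (p + 1)
      \<le> real m powr (p + 1) / (p + 1) + real (Suc m) powr p"
    using assms divide_right_mono[of _ _ "p + 1"]
    by (fastforce simp: diff_divide_distrib)
  with Suc show ?case
    by simp
qed (use assms in simp)

text \<open>The vertices of \<open>Y\<close> in the new class \<open>S\<close> pay for the largest
  indices \<open>j\<close>, those above \<open>card ((X - S) \<inter> Y)\<close>: each such
  \<open>j / \<rho>\<close> is at most \<open>card (X \<inter> Y) / \<rho>\<close>, hence at most
  \<open>card S\<close>. The smaller indices are paid for by the later classes, which is
  \<open>rest\<close>.\<close>

lemma greedy_step:
  fixes p \<rho> :: real
  assumes p: "p > 0" and \<rho>: "\<rho> \<ge> 1" and X: "finite X" and S: "S \<subseteq> X"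
    and card: "real (card (X \<inter> Y)) / \<rho> \<le> real (card S)"
    and new: "\<And>v. v \<in> S \<Longrightarrow> a v = real (card S)"
    and rest: "(\<Sum>j=1..card ((X - S) \<inter> Y). (real j / \<rho>) powr p) \<le> (\<Sum>v\<in>(X - S) \<inter> Y. a v powr p)"
  shows "(\<Sum>j=1..card (X \<inter> Y). (real j / \<rho>) powr p) \<le> (\<Sum>v\<in>X \<inter> Y. a v powr p)"
proof -
  let ?m = "card (X \<inter> Y)" and ?k = "card ((X - S) \<inter> Y)" and ?l = "card (S \<inter> Y)"
  have eq: "X \<inter> Y = (X - S) \<inter> Y \<union> S \<inter> Y" "(X - S) \<inter> Y \<inter> (S \<inter> Y) = {}"
    using S by auto
  have fin: "finite ((X - S) \<inter> Y)" "finite (S \<inter> Y)"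
    using X S finite_subset by auto
  have m: "?m = ?k + ?l"
    using eq fin card_Un_disjoint by metis
  have "(\<Sum>j=1..?m. (real j / \<rho>) powr p)
      = (\<Sum>j=1..?k. (real j / \<rho>) powr p) + (\<Sum>j=?k + 1..?k + ?l. (real j / \<rho>) powr p)"
    unfolding m by (rule sum.ub_add_nat) simp
  also have "(\<Sum>j=?k + 1..?k + ?l. (real j / \<rho>) powr p) \<le> (\<Sum>j=?k + 1..?k + ?l. real (card S) powr p)"
  proof (rule sum_mono)
    fix j assume "j \<in> {?k + 1..?k + ?l}"
    then have "real j \<le> real ?m"
      using m by auto
    then have "real j / \<rho> \<le> real ?m / \<rho>"
      using \<rho> by (simp add: divide_right_mono)
    then show "(real j / \<rho>) powr p \<le> real (card S) powr p"
      using card p \<rho> by (intro powr_mono2) auto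
  qed
  also have "\<dots> = (\<Sum>v\<in>S \<inter> Y. a v powr p)"
    using new by simp
  also have "(\<Sum>j=1..?k. (real j / \<rho>) powr p) + (\<Sum>v\<in>S \<inter> Y. a v powr p)
      \<le> (\<Sum>v\<in>(X - S) \<inter> Y. a v powr p) + (\<Sum>v\<in>S \<inter> Y. a v powr p)"
    using rest by simp
  also have "\<dots> = (\<Sum>v\<in>X \<inter> Y. a v powr p)"
    using eq fin by (metis sum.union_disjoint)
  finally show ?thesis
    by simp
qed

text \<open>A class of \<open>\<psi>\<close> with \<open>s\<close> vertices contributes
  \<open>s powr (p + 1)\<close> to the sum for \<open>\<psi>\<close>. Being independent, it
  contributes at least this divided by \<open>(p + 1) * \<rho> powr p\<close> to the sum for
  \<open>\<phi>\<close>. Adding up over the classes of \<open>\<psi>\<close> compares the two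
  sums.\<close>

lemma coloring_value_approx:
  fixes p \<rho> :: real and G :: "'a graph"
  assumes p: "p > 0" and \<rho>: "\<rho> \<ge> 1" and G: "simple_graph G" and \<psi>: "proper_coloring G \<psi>"
    and greedy: "\<And>Y. independent_set G Y \<Longrightarrow>
      (\<Sum>j=1..card Y. (real j / \<rho>) powr p) \<le> (\<Sum>v\<in>Y. real (color_class_size G \<phi> v) powr p)"
  shows "coloring_value p G \<psi> / (\<rho> * (p + 1) powr (1 / p)) \<le> coloring_value p G \<phi>"
proof -
  let ?V = "verts G" and ?K = "\<lambda>c. {v \<in> verts G. \<psi> v = c}"
  have fin: "finite ?V"
    using G by (simp add: simple_graph_def)
  have class_bound: "real (card (?K c)) powr (p + 1) / ((p + 1) * \<rho> powr p)
      \<le> (\<Sum>v\<in>?K c. real (color_class_size G \<phi> v) powr p)" for c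
  proof -
    have "independent_set G (?K c)"
      using \<psi> by (fastforce simp: independent_set_def proper_coloring_def)
    note greedy[OF this]
    also have "(\<Sum>j=1..card (?K c). (real j / \<rho>) powr p)
        = (\<Sum>j=1..card (?K c). real j powr p) / \<rho> powr p"
      using \<rho> by (simp add: powr_divide sum_divide_distrib)
    finally have "(\<Sum>j=1..card (?K c). real j powr p) / \<rho> powr p
        \<le> (\<Sum>v\<in>?K c. real (color_class_size G \<phi> v) powr p)" .
    moreover have "real (card (?K c)) powr (p + 1) / (p + 1) / \<rho> powr p
        \<le> (\<Sum>j=1..card (?K c). real j powr p) / \<rho> powr p"
      by (rule divide_right_mono[OF sum_powr_ge_integral[OF p]]) simp
    ultimately show ?thesis
      by simp
  qed
  have "(\<Sum>v\<in>?V. real (color_class_size G \<psi> v) powr p)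
      = (\<Sum>c\<in>\<psi> ` ?V. \<Sum>v\<in>?K c. real (color_class_size G \<psi> v) powr p)"
    by (rule sum.image_gen[OF fin])
  also have "\<dots> = (\<Sum>c\<in>\<psi> ` ?V. real (card (?K c)) powr (p + 1))"
  proof (rule sum.cong[OF refl])
    fix c assume "c \<in> \<psi> ` ?V"
    then have "card (?K c) > 0"
      using fin by (auto simp: card_gt_0_iff)
    then show "(\<Sum>v\<in>?K c. real (color_class_size G \<psi> v) powr p) = real (card (?K c)) powr (p + 1)"
      by (simp add: color_class_size_def powr_add mult.commute)
  qed
  finally have "(\<Sum>v\<in>?V. real (color_class_size G \<psi> v) powr p) / ((p + 1) * \<rho> powr p)
      = (\<Sum>c\<in>\<psi> ` ?V. real (card (?K c)) powr (p + 1) / ((p + 1) * \<rho> powr p))"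
    by (simp add: sum_divide_distrib)
  also have "\<dots> \<le> (\<Sum>c\<in>\<psi> ` ?V. \<Sum>v\<in>?K c. real (color_class_size G \<phi> v) powr p)"
    by (rule sum_mono[OF class_bound])
  also have "\<dots> = (\<Sum>v\<in>?V. real (color_class_size G \<phi> v) powr p)"
    by (rule sum.image_gen[OF fin, symmetric])
  finally have main: "(\<Sum>v\<in>?V. real (color_class_size G \<psi> v) powr p) / ((p + 1) * \<rho> powr p)
      \<le> (\<Sum>v\<in>?V. real (color_class_size G \<phi> v) powr p)" (is "?A / _ \<le> ?B") .
  \<comment> \<open>The divisor is the \<open>p\<close>-th power of
    \<open>\<rho> * (p + 1) powr (1 / p)\<close>, so it can be moved under the root.\<close>
  have "coloring_value p G \<psi> / (\<rho> * (p + 1) powr (1 / p))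
      = (1 / real (card ?V) * ?A / ((p + 1) * \<rho> powr p)) powr (1 / p)"
    using p \<rho> by (simp add: coloring_value_def p_mean_def powr_divide powr_mult powr_powr
        sum_nonneg mult.commute)
  also have "\<dots> \<le> (1 / real (card ?V) * ?B) powr (1 / p)"
  proof (rule powr_mono2)
    show "1 / real (card ?V) * ?A / ((p + 1) * \<rho> powr p) \<le> 1 / real (card ?V) * ?B"
      using mult_left_mono[OF main, of "1 / real (card ?V)"] by simp
    show "0 \<le> 1 / real (card ?V) * ?A / ((p + 1) * \<rho> powr p)"
      using p by (intro divide_nonneg_nonneg mult_nonneg_nonneg sum_nonneg) auto
  qed (use p in simp)
  finally show ?thesis
    by (simp add: coloring_value_def p_mean_def)
qed

lemma OPT_approx:
  fixes p \<rho> :: real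
  assumes "p > 0" and "\<rho> \<ge> 1" and G: "simple_graph G"
    and "\<And>Y. independent_set G Y \<Longrightarrow>
      (\<Sum>j=1..card Y. (real j / \<rho>) powr p) \<le> (\<Sum>v\<in>Y. real (color_class_size G \<phi> v) powr p)"
  shows "OPT p G / (\<rho> * (p + 1) powr (1 / p)) \<le> coloring_value p G \<phi>"
proof -
  have "OPT p G \<in> {coloring_value p G \<psi> |\<psi>. proper_coloring G \<psi>}"
    unfolding OPT_def by (rule Max_in[OF coloring_values_finite_nonempty[OF G]])
  then obtain \<psi> where "proper_coloring G \<psi>" "OPT p G = coloring_value p G \<psi>"
    by blast
  then show ?thesis
    using coloring_value_approx assms by metis
qed

subsection \<open>Induced subgraphs\<close>

text \<open>Instances have a vertex set \<open>{..<k}\<close>, so the induced subgraph is carried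
  over to positions: \<open>i\<close> stands for \<open>xs ! i\<close>. A list is used because the
  program imposes an order of its own on the vertices.\<close>

definition relabelled_subgraph :: "nat graph \<Rightarrow> nat list \<Rightarrow> nat graph" where
  "relabelled_subgraph G xs =
    ({..<length xs}, {{i, j} |i j. i < length xs \<and> j < length xs \<and> {xs ! i, xs ! j} \<in> edges G})"

lemma edge_relabelled_subgraph:
  assumes "i < length xs" and "j < length xs"
  shows "{i, j} \<in> edges (relabelled_subgraph G xs) \<longleftrightarrow> {xs ! i, xs ! j} \<in> edges G"
proof
  assume "{i, j} \<in> edges (relabelled_subgraph G xs)"
  then obtain i' j' where "{i, j} = {i', j'}" "{xs ! i', xs ! j'} \<in> edges G"
    by (auto simp: relabelled_subgraph_def)
  then show "{xs ! i, xs ! j} \<in> edges G"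
    by (auto simp: doubleton_eq_iff insert_commute)
qed (use assms in \<open>auto simp: relabelled_subgraph_def\<close>)

lemma relabelled_subgraph_instance:
  assumes "simple_graph G"
  shows "relabelled_subgraph G xs \<in> graph_instances"
proof -
  have "i \<noteq> j" if "{xs ! i, xs ! j} \<in> edges G" for i j
    using that assms by (auto simp: simple_graph_def)
  then show ?thesis
    by (auto simp: graph_instances_def simple_graph_def relabelled_subgraph_def card_insert_if)
qed

text \<open>Passing to the subgraph selects rows and columns of the matrix, so a program can produce
  this encoding by filtering bits, without computing with vertex numbers.\<close>

lemma encode_relabelled_subgraph:
  "encode_graph (relabelled_subgraph G xs) = replicate (length xs) True @ [False] @
     concat (map (\<lambda>u. map (\<lambda>v. {u, v} \<in> edges G) xs) xs)"
proof -
  let ?H = "relabelled_subgraph G xs"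
  have "map (\<lambda>u. map (\<lambda>v. {u, v} \<in> edges ?H) [0..<length xs]) [0..<length xs]
      = map (\<lambda>u. map (\<lambda>v. {u, v} \<in> edges G) xs) xs"
    by (intro nth_equalityI) (auto simp: edge_relabelled_subgraph)
  moreover have "card (verts ?H) = length xs"
    by (simp add: relabelled_subgraph_def)
  ultimately show ?thesis
    by (simp add: encode_graph_def)
qed

lemma independent_set_relabelled_subgraph:
  assumes "independent_set (relabelled_subgraph G xs) S" and "set xs \<subseteq> verts G"
  shows "independent_set G ((!) xs ` S)"
proof -
  have S: "i < length xs" if "i \<in> S" for i
    using assms(1) that by (auto simp: independent_set_def relabelled_subgraph_def)
  then have "{xs ! i, xs ! j} \<notin> edges G" if "i \<in> S" "j \<in> S" for i j
    using assms(1) that edge_relabelled_subgraph[of i xs j G]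
    by (simp add: independent_set_def)
  then show ?thesis
    using S assms(2) by (auto simp: independent_set_def)
qed

text \<open>The positions in \<open>xs\<close> of the vertices of \<open>Y\<close> form an
  independent set, and distinctness preserves its size. This is how the guarantee of the given
  algorithm is compared with every independent set \<open>Y\<close> of the original graph.\<close>

lemma independence_number_relabelled_subgraph_ge:
  assumes G: "simple_graph G" and xs: "distinct xs" and Y: "independent_set G Y"
  shows "card (set xs \<inter> Y) \<le> independence_number (relabelled_subgraph G xs)"
proof -
  let ?H = "relabelled_subgraph G xs" and ?Z = "{i. i < length xs \<and> xs ! i \<in> Y}"
  have "(!) xs ` ?Z = set xs \<inter> Y"
    by (auto simp: in_set_conv_nth)
  moreover have "inj_on ((!) xs) ?Z"
    using xs by (auto simp: inj_on_def nth_eq_iff_index_eq)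
  ultimately have card: "card (set xs \<inter> Y) = card ?Z"
    by (metis card_image)
  have "{i, j} \<notin> edges ?H" if "i \<in> ?Z" "j \<in> ?Z" for i j
    using that Y edge_relabelled_subgraph[of i xs j G] by (simp add: independent_set_def)
  then have "independent_set ?H ?Z"
    unfolding independent_set_def by (auto simp: relabelled_subgraph_def)
  moreover have "simple_graph ?H"
    using relabelled_subgraph_instance[OF G] by (simp add: graph_instances_def)
  ultimately show ?thesis
    unfolding card independence_number_def
    by (intro Max_ge independent_set_sizes_finite_nonempty(1)) auto
qed

subsection \<open>Running time of programs\<close>

text \<open>An upper bound in place of the exact time of \<open>exec\<close>: bounds can be rounded
  up, and branches of different length get a common one.\<close>

definition runs :: "com \<Rightarrow> state \<Rightarrow> nat \<Rightarrow> state \<Rightarrow> bool" where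
  "runs c s T s' \<longleftrightarrow> (\<exists>t\<le>T. exec c s t s')"

lemma runs_Seq:
  assumes "runs c1 s T1 s'" and "runs c2 s' T2 s''" and "T1 + T2 \<le> T"
  shows "runs (Seq c1 c2) s T s''"
proof -
  obtain t1 t2 where "exec c1 s t1 s'" "t1 \<le> T1" "exec c2 s' t2 s''" "t2 \<le> T2"
    using assms by (auto simp: runs_def)
  then show ?thesis
    using assms(3) unfolding runs_def by (intro exI[of _ "t1 + t2"]) (auto intro: exec.Seq)
qed

lemma runs_While_Empty: "s r = [] \<Longrightarrow> 1 \<le> T \<Longrightarrow> runs (While r c) s T s"
  using exec.While_Empty runs_def by blast

lemma runs_While_Nonempty:
  assumes "s r \<noteq> []" and "runs c s T1 s'" and "runs (While r c) s' T2 s''" and "1 + T1 + T2 \<le> T"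
  shows "runs (While r c) s T s''"
proof -
  obtain t1 t2 where "exec c s t1 s'" "t1 \<le> T1" "exec (While r c) s' t2 s''" "t2 \<le> T2"
    using assms by (auto simp: runs_def)
  then show ?thesis
    using assms(1,4) unfolding runs_def
    by (intro exI[of _ "1 + t1 + t2"]) (auto intro: exec.While_Nonempty[simplified])
qed

lemma runs_mono: "runs c s T s' \<Longrightarrow> T \<le> T' \<Longrightarrow> runs c s T' s'"
  unfolding runs_def by (meson order_trans)

section \<open>Loop-free programs: computing the final state and a time bound\<close>

fun loop_free :: "com \<Rightarrow> bool" where
  "loop_free (Seq c1 c2) \<longleftrightarrow> loop_free c1 \<and> loop_free c2"
| "loop_free (Case r c0 c1 c2) \<longleftrightarrow> loop_free c0 \<and> loop_free c1 \<and> loop_free c2"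
| "loop_free (While r c) \<longleftrightarrow> False"
| "loop_free _ \<longleftrightarrow> True"

text \<open>The values on loops are irrelevant.\<close>

fun effect :: "com \<Rightarrow> state \<Rightarrow> state" where
  "effect (Push r b) s = s(r := b # s r)"
| "effect (Pop r) s = s(r := tl (s r))"
| "effect (Seq c1 c2) s = effect c2 (effect c1 s)"
| "effect (Case r c0 c1 c2) s =
    (case s r of [] \<Rightarrow> effect c0 s | b # _ \<Rightarrow> if b then effect c2 s else effect c1 s)"
| "effect _ s = s"

text \<open>The maximum over the branches makes the bound independent of the state, so every pass
  through a loop gets the same budget.\<close>

fun cost :: "com \<Rightarrow> nat" where
  "cost (Seq c1 c2) = cost c1 + cost c2"
| "cost (Case r c0 c1 c2) = 1 + max (cost c0) (max (cost c1) (cost c2))"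
| "cost _ = 1"

lemma runs_loop_free: "loop_free c \<Longrightarrow> runs c s (cost c) (effect c s)"
proof (induction c arbitrary: s)
  case (Seq c1 c2)
  then show ?case
    by (auto intro: runs_Seq)
next
  case (Case r c0 c1 c2)
  then have "\<exists>t\<le>cost c0. exec c0 s t (effect c0 s)" "\<exists>t\<le>cost c1. exec c1 s t (effect c1 s)"
    "\<exists>t\<le>cost c2. exec c2 s t (effect c2 s)"
    by (auto simp: runs_def)
  then obtain t0 t1 t2 where t: "t0 \<le> cost c0" "exec c0 s t0 (effect c0 s)"
    "t1 \<le> cost c1" "exec c1 s t1 (effect c1 s)" "t2 \<le> cost c2" "exec c2 s t2 (effect c2 s)"
    by blast
  show ?case
  proof (cases "s r")
    case Nil
    with t show ?thesis
      unfolding runs_def by (intro exI[of _ "1 + t0"]) (auto intro: exec.Case_Empty[simplified])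
  next
    case (Cons b w)
    with t show ?thesis
      unfolding runs_def
      by (cases b; intro exI[of _ "1 + (if b then t2 else t1)"])
        (auto intro: exec.Case_True[simplified] exec.Case_False[simplified])
  qed
qed (auto simp: runs_def intro!: exI[of _ "Suc 0"] exec.Skip[simplified] exec.Push[simplified] exec.Pop[simplified])

text \<open>The form used in the inductions over loops: one pass is evaluated by simplifying
  \<open>effect\<close>, and the remaining run of the loop comes from the induction
  hypothesis.\<close>

lemma runs_While_effect:
  assumes "s r \<noteq> []" and "loop_free c" and "runs (While r c) (effect c s) T2 s''"
    and "1 + cost c + T2 \<le> T"
  shows "runs (While r c) s T s''"
  using assms runs_While_Nonempty runs_loop_free by blast

section \<open>Renaming and tracking the registers of a program\<close>

fun rename :: "(nat \<Rightarrow> nat) \<Rightarrow> com \<Rightarrow> com" where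
  "rename f Skip = Skip"
| "rename f (Push r b) = Push (f r) b"
| "rename f (Pop r) = Pop (f r)"
| "rename f (Seq c1 c2) = Seq (rename f c1) (rename f c2)"
| "rename f (Case r c0 c1 c2) = Case (f r) (rename f c0) (rename f c1) (rename f c2)"
| "rename f (While r c) = While (f r) (rename f c)"

text \<open>The states only have to agree on the range of \<open>f\<close>. The other registers can
  hold the data of a surrounding program, which survives the run.\<close>

lemma exec_rename:
  assumes "exec c s t s'" and "inj f" and "\<And>r. s0 (f r) = s r"
  shows "\<exists>s1. exec (rename f c) s0 t s1 \<and> (\<forall>r. s1 (f r) = s' r) \<and> (\<forall>r. r \<notin> range f \<longrightarrow> s1 r = s0 r)"
  using assms
proof (induction arbitrary: s0 rule: exec.induct)
  case (Push r b s)
  have "exec (rename f (Push r b)) s0 1 (s0(f r := b # s0 (f r)))"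
    by (simp only: rename.simps exec.Push)
  then show ?case
    using Push by (intro exI conjI) (auto simp: inj_eq)
next
  case (Pop r s)
  have "exec (rename f (Pop r)) s0 1 (s0(f r := tl (s0 (f r))))"
    by (simp only: rename.simps exec.Pop)
  then show ?case
    using Pop by (intro exI conjI) (auto simp: inj_eq)
next
  case (Seq c1 s t1 s' c2 t2 s'')
  obtain s1 where s1: "exec (rename f c1) s0 t1 s1" "\<forall>r. s1 (f r) = s' r"
    "\<forall>r. r \<notin> range f \<longrightarrow> s1 r = s0 r"
    using Seq by metis
  then obtain s2 where "exec (rename f c2) s1 t2 s2" "\<forall>r. s2 (f r) = s'' r"
    "\<forall>r. r \<notin> range f \<longrightarrow> s2 r = s1 r"
    using Seq by metis
  with s1 show ?case
    by (auto intro!: exI[of _ s2] exec.Seq)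
next
  case (While_Nonempty s r c t1 s' t2 s'')
  obtain s1 where s1: "exec (rename f c) s0 t1 s1" "\<forall>r. s1 (f r) = s' r"
    "\<forall>r. r \<notin> range f \<longrightarrow> s1 r = s0 r"
    using While_Nonempty by metis
  then obtain s2 where s2: "exec (While (f r) (rename f c)) s1 t2 s2" "\<forall>r. s2 (f r) = s'' r"
    "\<forall>r. r \<notin> range f \<longrightarrow> s2 r = s1 r"
    using While_Nonempty.IH(2)[of s1] While_Nonempty.prems by auto
  then have "exec (While (f r) (rename f c)) s0 (1 + t1 + t2) s2"
    using s1 While_Nonempty by (intro exec.While_Nonempty) auto
  with s1 s2 show ?case
    by (intro exI[of _ s2]) auto
next
  case (Case_False s r w c1 t s' c0 c2)
  then obtain s1 where "exec (rename f c1) s0 t s1 \<and> (\<forall>r. s1 (f r) = s' r) \<and>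
    (\<forall>r. r \<notin> range f \<longrightarrow> s1 r = s0 r)"
    by metis
  with Case_False show ?case
    by (intro exI[of _ s1]) (auto intro: exec.Case_False[simplified])
next
  case (Case_True s r w c2 t s' c0 c1)
  then obtain s1 where "exec (rename f c2) s0 t s1 \<and> (\<forall>r. s1 (f r) = s' r) \<and>
    (\<forall>r. r \<notin> range f \<longrightarrow> s1 r = s0 r)"
    by metis
  with Case_True show ?case
    by (intro exI[of _ s1]) (auto intro: exec.Case_True[simplified])
next
  case (Case_Empty s r c0 t s' c1 c2)
  then obtain s1 where "exec (rename f c0) s0 t s1 \<and> (\<forall>r. s1 (f r) = s' r) \<and>
    (\<forall>r. r \<notin> range f \<longrightarrow> s1 r = s0 r)"
    by metis
  with Case_Empty show ?case
    by (intro exI[of _ s1]) (auto intro: exec.Case_Empty[simplified])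
next
  case (Skip s)
  then show ?case
    by (intro exI[of _ s0]) (auto intro: exec.Skip[simplified])
next
  case (While_Empty s r c)
  then show ?case
    by (intro exI[of _ s0]) (auto intro: exec.While_Empty[simplified])
qed

fun registers :: "com \<Rightarrow> nat set" where
  "registers Skip = {}"
| "registers (Push r b) = {r}"
| "registers (Pop r) = {r}"
| "registers (Seq c1 c2) = registers c1 \<union> registers c2"
| "registers (Case r c0 c1 c2) = {r} \<union> registers c0 \<union> registers c1 \<union> registers c2"
| "registers (While r c) = {r} \<union> registers c"

text \<open>Lets a fixed program clear everything that another program may leave behind.\<close>

lemma finite_registers: "finite (registers c)"
  by (induction c) auto

lemma exec_unused_register: "exec c s t s' \<Longrightarrow> r \<notin> registers c \<Longrightarrow> s' r = s r"
  by (induction rule: exec.induct) auto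

text \<open>One step pushes at most one bit. This bounds the time for clearing the registers after a
  run.\<close>

lemma exec_length: "exec c s t s' \<Longrightarrow> length (s' r) \<le> length (s r) + t"
  by (induction rule: exec.induct) auto

section \<open>Moving and clearing stacks\<close>

definition transfer :: "nat \<Rightarrow> nat \<Rightarrow> com" where
  "transfer a b =
    Case a Skip (Seq (Pop a) (Push b False)) (Seq (Pop a) (Push b True))"

definition move :: "nat \<Rightarrow> nat \<Rightarrow> com" where
  "move a b = While a (transfer a b)"

text \<open>Each bit costs one loop test and three steps of \<open>transfer\<close>; the last test
  costs one more. Popping and pushing reverses the order.\<close>

lemma runs_move:
  assumes "a \<noteq> b" and "4 * length (s a) + 1 \<le> T"
  shows "runs (move a b) s T (s(a := [], b := rev (s a) @ s b))"
  using assms(2)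
proof (induction "s a" arbitrary: s T)
  case Nil
  then have "s(a := [], b := rev (s a) @ s b) = s"
    by (metis append.left_neutral fun_upd_triv rev.simps(1))
  then show ?case
    using Nil unfolding move_def by (metis runs_While_Empty le_add2 order_trans)
next
  case (Cons x xs)
  let ?s = "effect (transfer a b) s"
  have s: "?s = s(a := xs, b := x # s b)"
    using assms(1) by (cases x) (simp_all add: transfer_def Cons.hyps(2)[symmetric])
  have "runs (move a b) ?s (4 * length xs + 1) (?s(a := [], b := rev (?s a) @ ?s b))"
    using assms(1) by (intro Cons.hyps) (auto simp: s)
  moreover have "?s(a := [], b := rev (?s a) @ ?s b) = s(a := [], b := rev (s a) @ s b)"
    using assms(1) by (auto simp: s Cons.hyps(2)[symmetric])
  ultimately have "runs (While a (transfer a b)) ?s (4 * length xs + 1)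
      (s(a := [], b := rev (s a) @ s b))"
    by (simp only: move_def)
  then show ?case
    unfolding move_def
    by (rule runs_While_effect[rotated 2])
      (use Cons.prems in \<open>auto simp: transfer_def Cons.hyps(2)[symmetric]\<close>)
qed

fun clear :: "nat list \<Rightarrow> com" where
  "clear [] = Skip"
| "clear (r # rs) = Seq (While r (Pop r)) (clear rs)"

lemma runs_While_Pop: "2 * length (s r) + 1 \<le> T \<Longrightarrow> runs (While r (Pop r)) s T (s(r := []))"
proof (induction "s r" arbitrary: s T)
  case Nil
  then have "s(r := []) = s"
    by (metis fun_upd_triv)
  then show ?case
    using Nil by (metis runs_While_Empty le_add2 order_trans)
next
  case (Cons x xs)
  have "runs (While r (Pop r)) (s(r := tl (s r))) (2 * length xs + 1) ((s(r := tl (s r)))(r := []))"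
    by (intro Cons.hyps) (auto simp: Cons.hyps(2)[symmetric])
  then have "runs (While r (Pop r)) (effect (Pop r) s) (2 * length xs + 1) (s(r := []))"
    by simp
  then show ?case
    by (rule runs_While_effect[rotated 2])
      (use Cons.prems in \<open>auto simp: Cons.hyps(2)[symmetric]\<close>)
qed

lemma runs_clear:
  assumes "\<And>r. r \<in> set rs \<Longrightarrow> length (s r) \<le> B"
  shows "runs (clear rs) s (length rs * (2 * B + 1) + 1) (\<lambda>r. if r \<in> set rs then [] else s r)"
  using assms
proof (induction rs arbitrary: s)
  case Nil
  then show ?case
    by (auto simp: runs_def intro!: exec.Skip[simplified])
next
  case (Cons r rs)
  have "runs (clear rs) (s(r := [])) (length rs * (2 * B + 1) + 1)
      (\<lambda>q. if q \<in> set rs then [] else (s(r := [])) q)"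
    using Cons by auto
  moreover have "runs (While r (Pop r)) s (2 * B + 1) (s(r := []))"
    using Cons.prems by (auto intro!: runs_While_Pop)
  moreover have "(\<lambda>q. if q \<in> set rs then [] else (s(r := [])) q)
      = (\<lambda>q. if q \<in> set (r # rs) then [] else s q)"
    by auto
  ultimately show ?case
    by (auto intro!: runs_Seq)
qed

subsection \<open>The loops of the greedy program\<close>

text \<open>
  Registers: 0 is the adjacency matrix; 1 and 2 are two copies of the mask of uncolored vertices,
  for its rows and columns; 3, 5, 6 and 10 hold what has been popped from 2, 0, 1 and 9; 7 ends the parsing loop; 8 counts the rounds; 9 is the reversed list of colors.
  The given program works on the registers from 16 onwards. Copying to a stack reverses, so the
  vertices \<open>0, 1, \<dots>\<close> of the graph passed to it are the uncolored vertices in descending order.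
\<close>

definition parse :: com where
  "parse = Case 0 (Pop 7) (Seq (Pop 0) (Pop 7))
    (Seq (Pop 0) (Seq (Push 1 True) (Seq (Push 2 True) (Seq (Push 8 True) (Push 9 False)))))"

text \<open>One pass over the unary header sets up the masks, the round counter and the colors. All
  colors are 0, so only their terminators \<open>False\<close> are stored. Register 7 keeps the loop
  going until the separator is popped.\<close>

lemma runs_parse:
  assumes "s 0 = replicate n True @ False # M" and "s 7 = [True]" and "7 * n + 8 \<le> T"
  shows "runs (While 7 parse) s T (s(0 := M, 1 := replicate n True @ s 1,
    2 := replicate n True @ s 2, 7 := [], 8 := replicate n True @ s 8, 9 := replicate n False @ s 9))"
  using assms
proof (induction n arbitrary: s T)
  case 0
  let ?s = "effect parse s"
  have s: "?s = s(0 := M, 7 := [])"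
    using 0 by (simp add: parse_def)
  have "runs (While 7 parse) ?s 1 ?s"
    by (rule runs_While_Empty) (simp_all add: s)
  moreover have "?s = s(0 := M, 1 := replicate 0 True @ s 1,
    2 := replicate 0 True @ s 2, 7 := [], 8 := replicate 0 True @ s 8, 9 := replicate 0 False @ s 9)"
    by (auto simp: s)
  ultimately have "runs (While 7 parse) ?s 1 (s(0 := M, 1 := replicate 0 True @ s 1,
    2 := replicate 0 True @ s 2, 7 := [], 8 := replicate 0 True @ s 8, 9 := replicate 0 False @ s 9))"
    by (simp only:)
  then show ?case
    by (rule runs_While_effect[rotated 2]) (use 0 in \<open>simp_all add: parse_def\<close>)
next
  case (Suc n)
  let ?s = "effect parse s"
  have s: "?s = s(0 := replicate n True @ False # M, 1 := True # s 1, 2 := True # s 2,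
      8 := True # s 8, 9 := False # s 9)"
    using Suc.prems by (simp add: parse_def)
  have "runs (While 7 parse) ?s (7 * n + 8) (?s(0 := M, 1 := replicate n True @ ?s 1,
    2 := replicate n True @ ?s 2, 7 := [], 8 := replicate n True @ ?s 8, 9 := replicate n False @ ?s 9))"
    by (rule Suc.IH) (use Suc.prems in \<open>simp_all add: s\<close>)
  moreover have "?s(0 := M, 1 := replicate n True @ ?s 1,
    2 := replicate n True @ ?s 2, 7 := [], 8 := replicate n True @ ?s 8, 9 := replicate n False @ ?s 9)
   = s(0 := M, 1 := replicate (Suc n) True @ s 1,
    2 := replicate (Suc n) True @ s 2, 7 := [], 8 := replicate (Suc n) True @ s 8,
    9 := replicate (Suc n) False @ s 9)"
    by (auto simp: s fun_eq_iff replicate_app_Cons_same)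
  ultimately have "runs (While 7 parse) ?s (7 * n + 8) (s(0 := M, 1 := replicate (Suc n) True @ s 1,
    2 := replicate (Suc n) True @ s 2, 7 := [], 8 := replicate (Suc n) True @ s 8,
    9 := replicate (Suc n) False @ s 9))"
    by (simp only:)
  then show ?case
    by (rule runs_While_effect[rotated 2]) (use Suc.prems in \<open>simp_all add: parse_def\<close>)
qed

section \<open>Writing the induced subgraph as input for the given program\<close>

definition filter_entry :: com where
  "filter_entry = Case 2 Skip
     (Seq (Pop 2) (Seq (Push 3 False) (transfer 0 5)))
     (Seq (Pop 2) (Seq (Push 3 True) (Case 1 Skip (transfer 0 5)
       (Case 0 Skip (Seq (Pop 0) (Seq (Push 5 False) (Push 16 False)))
         (Seq (Pop 0) (Seq (Push 5 True) (Push 16 True)))))))"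

text \<open>The bit \<open>a\<close> of the row is read without being popped, as all entries of the
  row share it. The popped bits are kept in 3 and 5, from where the mask and the matrix can be
  restored.\<close>

lemma runs_filter_entries:
  assumes "s 0 = map e vs @ M" and "s 1 = a # w" and "s 2 = map al vs" and "9 * length vs + 1 \<le> T"
  shows "runs (While 2 filter_entry) s T (s(0 := M, 2 := [], 3 := rev (map al vs) @ s 3,
    5 := rev (map e vs) @ s 5, 16 := rev (map e (filter (\<lambda>v. a \<and> al v) vs)) @ s 16))"
  using assms
proof (induction vs arbitrary: s T)
  case Nil
  then have "s(0 := M, 2 := [], 3 := rev (map al []) @ s 3,
    5 := rev (map e []) @ s 5, 16 := rev (map e (filter (\<lambda>v. a \<and> al v) [])) @ s 16) = s"
    by (auto simp: fun_eq_iff)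
  then show ?case
    using Nil by (simp only:) (rule runs_While_Empty, simp_all)
next
  case (Cons v vs)
  let ?s = "effect filter_entry s"
  let ?post = "\<lambda>s vs. s(0 := M, 2 := [], 3 := rev (map al vs) @ s 3,
    5 := rev (map e vs) @ s 5, 16 := rev (map e (filter (\<lambda>v. a \<and> al v) vs)) @ s 16)"
  have s: "?s = s(0 := map e vs @ M, 2 := map al vs, 3 := al v # s 3, 5 := e v # s 5,
      16 := (if a \<and> al v then [e v] else []) @ s 16)"
    using Cons.prems by (cases a; cases "al v"; cases "e v")
      (auto simp: filter_entry_def transfer_def fun_eq_iff)
  have "runs (While 2 filter_entry) ?s (9 * length vs + 1) (?post ?s vs)"
    by (rule Cons.IH) (use Cons.prems in \<open>simp_all add: s\<close>)
  moreover have "?post ?s vs = ?post s (v # vs)"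
    by (auto simp: s fun_eq_iff)
  ultimately have "runs (While 2 filter_entry) ?s (9 * length vs + 1) (?post s (v # vs))"
    by (simp only:)
  then show ?case
    by (rule runs_While_effect[rotated 2])
      (use Cons.prems in \<open>simp_all add: filter_entry_def transfer_def\<close>)
qed

definition filter_row :: com where
  "filter_row = Seq (While 2 filter_entry) (Seq (move 3 2) (transfer 1 6))"

text \<open>The column mask is moved back from 3 after every row, and two reversals restore its
  order. A row costs 9 steps per entry for filtering, 4 per entry for restoring the mask, and a
  constant.\<close>

lemma runs_filter_rows:
  assumes "s 0 = concat (map (\<lambda>u. map (e u) vs) us) @ M" and "s 1 = map al us"
    and "s 2 = map al vs" and "s 3 = []" and "length us * (13 * length vs + 6) + 1 \<le> T"
  shows "runs (While 1 filter_row) s T (s(0 := M, 1 := [],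
    5 := rev (concat (map (\<lambda>u. map (e u) vs) us)) @ s 5, 6 := rev (map al us) @ s 6,
    16 := rev (concat (map (\<lambda>u. map (e u) (filter al vs)) (filter al us))) @ s 16))"
  using assms
proof (induction us arbitrary: s T)
  case Nil
  then have "s(0 := M, 1 := [],
    5 := rev (concat (map (\<lambda>u. map (e u) vs) [])) @ s 5, 6 := rev (map al []) @ s 6,
    16 := rev (concat (map (\<lambda>u. map (e u) (filter al vs)) (filter al []))) @ s 16) = s"
    by (auto simp: fun_eq_iff)
  then show ?case
    using Nil by (simp only:) (rule runs_While_Empty, simp_all)
next
  case (Cons u us)
  let ?rest = "concat (map (\<lambda>u. map (e u) vs) us) @ M"
  let ?s1 = "s(0 := ?rest, 2 := [], 3 := rev (map al vs) @ s 3,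
    5 := rev (map (e u) vs) @ s 5, 16 := rev (map (e u) (filter (\<lambda>v. al u \<and> al v) vs)) @ s 16)"
  let ?s2 = "?s1(3 := [], 2 := rev (?s1 3) @ ?s1 2)"
  let ?s3 = "effect (transfer 1 6) ?s2"
  let ?post = "\<lambda>s us. s(0 := M, 1 := [],
    5 := rev (concat (map (\<lambda>u. map (e u) vs) us)) @ s 5, 6 := rev (map al us) @ s 6,
    16 := rev (concat (map (\<lambda>u. map (e u) (filter al vs)) (filter al us))) @ s 16)"
  have entries: "runs (While 2 filter_entry) s (9 * length vs + 1) ?s1"
    by (rule runs_filter_entries[where w = "map al us"]) (use Cons.prems in simp_all)
  have restore: "runs (move 3 2) ?s1 (4 * length vs + 1) ?s2"
    by (rule runs_move) (use Cons.prems in simp_all)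
  have "loop_free (transfer 1 6)" "cost (transfer 1 6) = 3"
    by (simp_all add: transfer_def)
  then have mask: "runs (transfer 1 6) ?s2 3 ?s3"
    using runs_loop_free[of "transfer 1 6" ?s2] by (simp only:)
  have row: "runs filter_row s (13 * length vs + 5) ?s3"
    unfolding filter_row_def
    by (rule runs_Seq[OF entries runs_Seq[OF restore mask order_refl]]) simp
  have s3: "?s3 = s(0 := ?rest, 1 := map al us, 5 := rev (map (e u) vs) @ s 5, 6 := al u # s 6,
      16 := rev (map (e u) (filter (\<lambda>v. al u \<and> al v) vs)) @ s 16)"
    using Cons.prems by (cases "al u") (auto simp: transfer_def fun_eq_iff)
  have "runs (While 1 filter_row) ?s3 (length us * (13 * length vs + 6) + 1) (?post ?s3 us)"
    by (rule Cons.IH) (unfold s3, use Cons.prems in simp_all)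
  moreover have "?post ?s3 us = ?post s (u # us)"
    unfolding s3 by (auto simp: fun_eq_iff)
  ultimately have "runs (While 1 filter_row) ?s3 (length us * (13 * length vs + 6) + 1) (?post s (u # us))"
    by (simp only:)
  with row show ?case
    by (rule runs_While_Nonempty[rotated]) (use Cons.prems in simp_all)
qed

definition header_bit :: com where
  "header_bit = Case 2 Skip (Pop 2) (Seq (Pop 2) (Push 16 True))"

text \<open>On a stack the header is pushed last, after the matrix and the separator. The column
  mask may be used up here, since \<open>update\<close> writes both masks anew.\<close>

lemma runs_header:
  assumes "s 2 = map al vs" and "4 * length vs + 1 \<le> T"
  shows "runs (While 2 header_bit) s T
    (s(2 := [], 16 := replicate (length (filter al vs)) True @ s 16))"
  using assms
proof (induction vs arbitrary: s T)
  case Nil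
  then have "s(2 := [], 16 := replicate (length (filter al [])) True @ s 16) = s"
    by (auto simp: fun_eq_iff)
  then show ?case
    using Nil by (simp only:) (rule runs_While_Empty, simp_all)
next
  case (Cons v vs)
  let ?s = "effect header_bit s"
  let ?post = "\<lambda>s vs. s(2 := [], 16 := replicate (length (filter al vs)) True @ s 16)"
  have s: "?s = s(2 := map al vs, 16 := (if al v then [True] else []) @ s 16)"
    using Cons.prems by (cases "al v") (auto simp: header_bit_def fun_eq_iff)
  have "runs (While 2 header_bit) ?s (4 * length vs + 1) (?post ?s vs)"
    by (rule Cons.IH) (use Cons.prems in \<open>simp_all add: s\<close>)
  moreover have "?post ?s vs = ?post s (v # vs)"
    by (auto simp: s fun_eq_iff replicate_app_Cons_same)
  ultimately have "runs (While 2 header_bit) ?s (4 * length vs + 1) (?post s (v # vs))"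
    by (simp only:)
  then show ?case
    by (rule runs_While_effect[rotated 2]) (use Cons.prems in \<open>simp_all add: header_bit_def\<close>)
qed

text \<open>
  Register 9 is reversed, so the terminator of a color comes before its digits, and it is there
  that the mask and the output of the given program are consulted.
\<close>

definition update :: com where
  "update = Case 9 Skip
     (Seq (Pop 9) (Seq (Push 10 False) (Case 6 Skip
       (Seq (Pop 6) (Seq (Push 1 False) (Push 2 False)))
       (Seq (Pop 6) (Case 16 Skip
         (Seq (Pop 16) (Seq (Push 1 True) (Seq (Push 2 True) (Push 10 True))))
         (Seq (Pop 16) (Seq (Push 1 False) (Push 2 False))))))))
     (Seq (Pop 9) (Push 10 True))"

text \<open>Digits and terminators are handled by the same loop, so the passes over the digits of
  one color are put in front of an arbitrary continuation of that loop.\<close>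

lemma runs_update_color:
  assumes "s 9 = replicate k True @ C" and "runs (While 9 update) (s(9 := C, 10 := replicate k True @ s 10)) T s'"
    and "11 * k + T \<le> T'"
  shows "runs (While 9 update) s T' s'"
  using assms
proof (induction k arbitrary: s T')
  case 0
  then have eq: "s(9 := C, 10 := replicate 0 True @ s 10) = s"
    by (auto simp: fun_eq_iff)
  show ?case
    by (rule runs_mono[OF 0(2)[unfolded eq]]) (use 0 in simp)
next
  case (Suc k)
  let ?s = "effect update s"
  have s: "?s = s(9 := replicate k True @ C, 10 := True # s 10)"
    using Suc.prems by (simp add: update_def)
  have eq: "?s(9 := C, 10 := replicate k True @ ?s 10) = s(9 := C, 10 := replicate (Suc k) True @ s 10)"
    by (auto simp: s fun_eq_iff replicate_app_Cons_same)
  have "runs (While 9 update) (?s(9 := C, 10 := replicate k True @ ?s 10)) T s'"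
    unfolding eq by (rule Suc.prems(2))
  then have "runs (While 9 update) ?s (11 * k + T) s'"
    by (rule Suc.IH[rotated]) (simp_all add: s)
  then show ?case
    by (rule runs_While_effect[rotated 2]) (use Suc.prems in \<open>simp_all add: update_def\<close>)
qed

text \<open>Registers 6, 9 and 16 list the vertices in the same order, 16 only the uncolored ones;
  so its top bit belongs to the next uncolored vertex and is popped exactly there. The factor
  \<open>Suc c\<close> counts the digits of a color and its terminator.\<close>

lemma runs_update:
  assumes "s 9 = concat (map (\<lambda>v. False # replicate (\<phi> v) True) vs)" and "s 6 = map al vs"
    and "s 16 = map sel (filter al vs) @ w"
    and "\<And>v. v \<in> set vs \<Longrightarrow> al' v \<longleftrightarrow> al v \<and> \<not> sel v"
    and "\<And>v. v \<in> set vs \<Longrightarrow> \<phi>' v = (if al v \<and> \<not> sel v then Suc (\<phi> v) else \<phi> v)"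
    and "\<And>v. v \<in> set vs \<Longrightarrow> \<phi> v \<le> c"
    and "11 * (length vs * Suc c) + 1 \<le> T"
  shows "runs (While 9 update) s T (s(1 := rev (map al' vs) @ s 1, 2 := rev (map al' vs) @ s 2,
    6 := [], 9 := [], 10 := concat (map (\<lambda>v. replicate (\<phi>' v) True @ [False]) (rev vs)) @ s 10,
    16 := w))"
  using assms
proof (induction vs arbitrary: s T)
  case Nil
  then have "s(1 := rev (map al' []) @ s 1, 2 := rev (map al' []) @ s 2,
    6 := [], 9 := [], 10 := concat (map (\<lambda>v. replicate (\<phi>' v) True @ [False]) (rev [])) @ s 10,
    16 := w) = s"
    by (auto simp: fun_eq_iff)
  then show ?case
    using Nil by (simp only:) (rule runs_While_Empty, simp_all)
next
  case (Cons v vs)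
  let ?C = "concat (map (\<lambda>v. False # replicate (\<phi> v) True) vs)"
  let ?s = "effect update s"
  let ?s1 = "?s(9 := ?C, 10 := replicate (\<phi> v) True @ ?s 10)"
  let ?post = "\<lambda>s vs. s(1 := rev (map al' vs) @ s 1, 2 := rev (map al' vs) @ s 2,
    6 := [], 9 := [], 10 := concat (map (\<lambda>v. replicate (\<phi>' v) True @ [False]) (rev vs)) @ s 10,
    16 := w)"
  have v: "al' v \<longleftrightarrow> al v \<and> \<not> sel v" "\<phi>' v = (if al v \<and> \<not> sel v then Suc (\<phi> v) else \<phi> v)" "\<phi> v \<le> c"
    using Cons.prems by simp_all
  \<comment> \<open>The extra \<open>True\<close> on top of the terminator is the increment of the
    color of a vertex that stays uncolored.\<close>
  have s: "?s = s(1 := al' v # s 1, 2 := al' v # s 2, 6 := map al vs,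
      9 := replicate (\<phi> v) True @ ?C, 10 := (if al' v then [True, False] else [False]) @ s 10,
      16 := map sel (filter al vs) @ w)"
    using Cons.prems(1-3) v by (cases "al v"; cases "sel v") (auto simp: update_def fun_eq_iff)
  have s1: "?s1 = s(1 := al' v # s 1, 2 := al' v # s 2, 6 := map al vs,
      9 := ?C, 10 := replicate (\<phi>' v) True @ [False] @ s 10,
      16 := map sel (filter al vs) @ w)"
    using v by (auto simp: s fun_eq_iff replicate_app_Cons_same)
  have "runs (While 9 update) ?s1 (11 * (length vs * Suc c) + 1) (?post ?s1 vs)"
    by (rule Cons.IH) (use Cons.prems in \<open>simp_all add: s1\<close>)
  moreover have "?post ?s1 vs = ?post s (v # vs)"
    by (auto simp: s1 fun_eq_iff)
  ultimately have "runs (While 9 update) ?s1 (11 * (length vs * Suc c) + 1) (?post s (v # vs))"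
    by (simp only:)
  then have "runs (While 9 update) ?s (11 * c + (11 * (length vs * Suc c) + 1)) (?post s (v # vs))"
    by (rule runs_update_color[rotated]) (use v in \<open>simp_all add: s\<close>)
  then show ?case
    by (rule runs_While_effect[rotated 2]) (use Cons.prems in \<open>simp_all add: update_def\<close>)
qed

subsection \<open>The greedy program\<close>

text \<open>The last two facts serve the cleanup: from register 16 on, only those up to
  \<open>15 + N\<close> can be nonempty, and their contents are bounded.\<close>

lemma runs_renamed_program:
  assumes A: "exec A (\<lambda>r. if r = 0 then x else []) t sA" and N: "registers A \<subseteq> {..<N}" "0 < N"
    and s: "\<And>r. s (r + 16) = (if r = 0 then x else [])"
  obtains s' where "runs (rename (\<lambda>r. r + 16) A) s t s'" "s' 16 = sA 0" "\<forall>r<16. s' r = s r"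
    "\<forall>r\<ge>16 + N. s' r = []" "\<forall>r\<ge>16. length (s' r) \<le> length x + t"
proof -
  have inj: "inj (\<lambda>r::nat. r + 16)"
    by (simp add: inj_def)
  obtain s' where s': "exec (rename (\<lambda>r. r + 16) A) s t s'" "\<And>r. s' (r + 16) = sA r"
    "\<And>r. r \<notin> range (\<lambda>r. r + 16) \<Longrightarrow> s' r = s r"
    using exec_rename[OF A inj, of s] s by auto
  show thesis
  proof
    show "runs (rename (\<lambda>r. r + 16) A) s t s'"
      using s'(1) by (auto simp: runs_def)
    show "s' 16 = sA 0"
      using s'(2)[of 0] by simp
    show "\<forall>r<16. s' r = s r"
      by (intro allI impI s'(3)) auto
    show "\<forall>r\<ge>16 + N. s' r = []"
    proof (intro allI impI)
      fix r assume r: "16 + N \<le> r"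
      \<comment> \<open>Register 16 starts with the input \<open>x\<close>; \<open>0 < N\<close>
        excludes it from the registers that are claimed to be empty.\<close>
      then have "r - 16 \<notin> registers A" "r \<noteq> 16"
        using N by (auto dest!: subsetD)
      then have "sA (r - 16) = []"
        using exec_unused_register[OF A, of "r - 16"] r by auto
      then show "s' r = []"
        using s'(2)[of "r - 16"] r by simp
    qed
    show "\<forall>r\<ge>16. length (s' r) \<le> length x + t"
    proof (intro allI impI)
      fix r :: nat assume "16 \<le> r"
      then show "length (s' r) \<le> length x + t"
        using exec_length[OF A, of "r - 16"] s'(2)[of "r - 16"] by (cases "r = 16") auto
    qed
  qed
qed

definition unary_list :: "('a \<Rightarrow> nat) \<Rightarrow> 'a list \<Rightarrow> bool list" where
  "unary_list \<phi> vs = concat (map (\<lambda>v. replicate (\<phi> v) True @ [False]) vs)"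

lemma rev_unary_list:
  "rev (unary_list \<phi> vs) = concat (map (\<lambda>v. False # replicate (\<phi> v) True) (rev vs))"
  by (simp add: unary_list_def rev_concat rev_map comp_def)

lemma length_unary_list_le:
  assumes "\<And>v. v \<in> set vs \<Longrightarrow> \<phi> v \<le> c"
  shows "length (unary_list \<phi> vs) \<le> length vs * Suc c"
  using assms
proof (induction vs)
  case (Cons v vs)
  then have "length (unary_list \<phi> vs) \<le> length vs * Suc c" "\<phi> v \<le> c"
    by simp_all
  then show ?case
    by (simp add: unary_list_def)
qed (simp add: unary_list_def)

text \<open>The registers between rounds. Those not listed are empty, as the given program expects
  of its working registers.\<close>

definition loop_state :: "bool list \<Rightarrow> bool list \<Rightarrow> bool list \<Rightarrow> bool list \<Rightarrow> state" where
  "loop_state M w C k = (\<lambda>_. [])(0 := M, 1 := w, 2 := w, 8 := k, 9 := C)"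

text \<open>Register 16 is filled from the bottom up: matrix, separator, header. The final
  \<open>clear\<close> prepares the working registers for the next round.\<close>

definition greedy_round :: "com \<Rightarrow> nat \<Rightarrow> com" where
  "greedy_round A N = Seq (While 1 filter_row) (Seq (move 5 0) (Seq (Push 16 False)
    (Seq (While 2 header_bit) (Seq (rename (\<lambda>r. r + 16) A)
      (Seq (While 9 update) (Seq (move 10 9) (clear [16..<16 + N])))))))"

text \<open>Isolates the stack manipulation from the graph theory: \<open>al\<close> marks the
  uncolored elements, and \<open>sel\<close> is the selection that the given program returns for
  \<open>xs\<close>. \<open>T\<close> adds the bounds of the eight phases in their order;
  \<open>Suc (Suc c)\<close> allows for a color raised by one and its terminator.\<close>

lemma runs_greedy_round:
  fixes vs :: "'v list" and al al' sel :: "'v \<Rightarrow> bool" and e :: "'v \<Rightarrow> 'v \<Rightarrow> bool"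
    and \<phi> \<phi>' :: "'v \<Rightarrow> nat"
  defines "xs \<equiv> rev (filter al vs)"
  defines "x \<equiv> replicate (length xs) True @ [False] @ concat (map (\<lambda>u. map (e u) xs) xs)"
  defines "M \<equiv> concat (map (\<lambda>u. map (e u) vs) vs)"
  assumes A: "computes_in A x t (map sel xs)" and N: "registers A \<subseteq> {..<N}" "0 < N"
    and al': "\<And>v. al' v \<longleftrightarrow> al v \<and> \<not> sel v"
    and \<phi>': "\<And>v. \<phi>' v = (if al v \<and> \<not> sel v then Suc (\<phi> v) else \<phi> v)"
    and c: "\<And>v. v \<in> set vs \<Longrightarrow> \<phi> v \<le> c"
    and n: "length vs = n" and B: "t \<le> B" and L: "length x \<le> L"
    and T: "(n * (13 * n + 6) + 1) + ((4 * (n * n) + 1) + (1 + ((4 * n + 1) +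
      (B + ((11 * (n * Suc c) + 1) + ((4 * (n * Suc (Suc c)) + 1) + (N * (2 * (L + B) + 1) + 1))))))) \<le> T"
  shows "runs (greedy_round A N) (loop_state M (map al vs) (rev (unary_list \<phi> vs)) K) T
    (loop_state M (map al' vs) (rev (unary_list \<phi>' vs)) K)"
proof -
  let ?w = "map al vs" and ?C = "rev (unary_list \<phi> vs)"
  let ?s0 = "loop_state M ?w ?C K"
  let ?s1 = "?s0(0 := [], 1 := [], 5 := rev M, 6 := rev ?w,
    16 := rev (concat (map (\<lambda>u. map (e u) (filter al vs)) (filter al vs))))"
  let ?s2 = "?s1(5 := [], 0 := M)"
  let ?s3 = "?s2(16 := False # ?s2 16)"
  let ?s4 = "?s3(2 := [], 16 := x)"
  have M: "length M = n * n"
    using n by (simp add: M_def length_concat comp_def sum_list_triv)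
  have 1: "runs (While 1 filter_row) ?s0 (n * (13 * n + 6) + 1) ?s1"
  proof -
    have "runs (While 1 filter_row) ?s0 (n * (13 * n + 6) + 1) (?s0(0 := [], 1 := [],
      5 := rev (concat (map (\<lambda>u. map (e u) vs) vs)) @ ?s0 5, 6 := rev (map al vs) @ ?s0 6,
      16 := rev (concat (map (\<lambda>u. map (e u) (filter al vs)) (filter al vs))) @ ?s0 16))"
      by (rule runs_filter_rows) (simp_all add: loop_state_def M_def n)
    then show ?thesis
      by (simp add: loop_state_def M_def)
  qed
  have 2: "runs (move 5 0) ?s1 (4 * (n * n) + 1) ?s2"
    using runs_move[of 5 0 ?s1 "4 * (n * n) + 1"] by (simp add: M)
  have 3: "runs (Push 16 False) ?s2 1 ?s3"
    unfolding runs_def by (blast intro: exec.Push)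
  have 4: "runs (While 2 header_bit) ?s3 (4 * n + 1) ?s4"
  proof -
    have "runs (While 2 header_bit) ?s3 (4 * n + 1)
        (?s3(2 := [], 16 := replicate (length (filter al vs)) True @ ?s3 16))"
      by (rule runs_header) (simp_all add: loop_state_def n)
    \<comment> \<open>Reversing the concatenation reverses the rows and the entries within each row,
      which gives the matrix for the reversed list \<open>xs\<close>.\<close>
    moreover have "replicate (length (filter al vs)) True @ ?s3 16 = x"
      by (simp add: x_def xs_def rev_concat rev_map comp_def)
    ultimately show ?thesis
      by (simp only:)
  qed
  obtain sA where sA: "exec A (\<lambda>r. if r = 0 then x else []) t sA" "sA 0 = map sel xs"
    using A by (auto simp: computes_in_def)
  have input: "?s4 (r + 16) = (if r = 0 then x else [])" for r
    by (simp add: loop_state_def)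
  obtain s5 where s5: "runs (rename (\<lambda>r. r + 16) A) ?s4 t s5" "s5 16 = sA 0"
    "\<forall>r<16. s5 r = ?s4 r" "\<forall>r\<ge>16 + N. s5 r = []"
    "\<forall>r\<ge>16. length (s5 r) \<le> length x + t"
    by (rule runs_renamed_program[OF sA(1) N input])
  note s5 = s5(1,2) s5(3-5)[rule_format]
  have 5: "runs (rename (\<lambda>r. r + 16) A) ?s4 B s5"
    using s5(1) B by (rule runs_mono)
  let ?s6 = "s5(1 := map al' vs, 2 := map al' vs, 6 := [], 9 := [], 10 := unary_list \<phi>' vs, 16 := [])"
  have 6: "runs (While 9 update) s5 (11 * (n * Suc c) + 1) ?s6"
  proof -
    have "runs (While 9 update) s5 (11 * (n * Suc c) + 1) (s5(1 := rev (map al' (rev vs)) @ s5 1,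
        2 := rev (map al' (rev vs)) @ s5 2, 6 := [], 9 := [],
        10 := concat (map (\<lambda>v. replicate (\<phi>' v) True @ [False]) (rev (rev vs))) @ s5 10, 16 := []))"
    proof (rule runs_update[where \<phi> = \<phi> and al = al and sel = sel and c = c])
      show "s5 9 = concat (map (\<lambda>v. False # replicate (\<phi> v) True) (rev vs))"
        using s5(3)[of 9] by (simp add: loop_state_def rev_unary_list)
      show "s5 6 = map al (rev vs)"
        using s5(3)[of 6] by (simp add: loop_state_def rev_map)
      show "s5 16 = map sel (filter al (rev vs)) @ []"
        using s5(2) sA(2) by (simp add: xs_def rev_filter)
    qed (use al' \<phi>' c n in simp_all)
    then show ?thesis
      using s5(3)[of 1] s5(3)[of 2] s5(3)[of 10]
      by (simp add: loop_state_def unary_list_def rev_map)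
  qed
  let ?s7 = "?s6(10 := [], 9 := rev (unary_list \<phi>' vs))"
  have "length (unary_list \<phi>' vs) \<le> n * Suc (Suc c)"
    unfolding n[symmetric] by (rule length_unary_list_le) (use c in \<open>auto simp: \<phi>' intro: le_SucI\<close>)
  then have 7: "runs (move 10 9) ?s6 (4 * (n * Suc (Suc c)) + 1) ?s7"
    using runs_move[of 10 9 ?s6 "4 * (n * Suc (Suc c)) + 1"] by simp
  have bound: "length (?s7 r) \<le> L + B" if "r \<in> set [16..<16 + N]" for r
    using that s5(5)[of r] B L by auto
  have "runs (clear [16..<16 + N]) ?s7 (N * (2 * (L + B) + 1) + 1)
      (\<lambda>r. if r \<in> set [16..<16 + N] then [] else ?s7 r)"
    using runs_clear[where s = ?s7 and rs = "[16..<16 + N]" and B = "L + B", OF bound]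
    by (simp only: length_upt add_diff_cancel_left')
  \<comment> \<open>Registers below 16 are known from the phases, those up to \<open>15 + N\<close>
    have been cleared, and those beyond are still empty.\<close>
  moreover have "(\<lambda>r. if r \<in> set [16..<16 + N] then [] else ?s7 r)
      = loop_state M (map al' vs) (rev (unary_list \<phi>' vs)) K"
  proof
    fix r
    show "(if r \<in> set [16..<16 + N] then [] else ?s7 r)
      = loop_state M (map al' vs) (rev (unary_list \<phi>' vs)) K r"
      using s5(3)[of r] s5(4)[of r] by (cases "r < 16") (auto simp: loop_state_def)
  qed
  ultimately have 8: "runs (clear [16..<16 + N]) ?s7 (N * (2 * (L + B) + 1) + 1)
      (loop_state M (map al' vs) (rev (unary_list \<phi>' vs)) K)"
    by (simp only:)
  note seq = runs_Seq[OF _ _ order_refl]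
  show ?thesis
    unfolding greedy_round_def
    by (rule runs_mono[OF _ T])
      (rule seq[OF 1 seq[OF 2 seq[OF 3 seq[OF 4 seq[OF 5 seq[OF 6 seq[OF 7 8]]]]]]])
qed


section \<open>A greedy round on a graph\<close>

lemma poly_nat_mono:
  fixes q :: "nat poly"
  shows "x \<le> y \<Longrightarrow> poly q x \<le> poly q y"
  by (induction q) (auto intro!: add_mono mult_le_mono)

text \<open>\<open>L\<close> is the length of \<open>encode_graph G\<close> and bounds the encoding
  of every induced subgraph, and \<open>n\<close> replaces the current color in the time bound.
  Hence the same \<open>T\<close> serves every round.\<close>

lemma runs_greedy_round_graph:
  fixes \<rho> :: real and q :: "nat poly"
  assumes G: "simple_graph G" and V: "verts G = {..<n}"
    and A: "\<And>H. H \<in> graph_instances \<Longrightarrow> \<exists>t S.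
      (independent_set H S \<and> real (card S) \<ge> real (independence_number H) / \<rho>) \<and>
      computes_in A (encode_graph H) t (encode_vertex_set H S) \<and> t \<le> poly q (length (encode_graph H))"
    and \<rho>: "\<rho> \<ge> 1" and N: "registers A \<subseteq> {..<N}" "0 < N"
    and X: "X \<subseteq> {..<n}" and \<phi>: "\<And>v. v < n \<Longrightarrow> \<phi> v \<le> c" "c \<le> n"
    and L: "L = n * n + n + 1"
    and M: "M = concat (map (\<lambda>u. map (\<lambda>v. {u, v} \<in> edges G) [0..<n]) [0..<n])"
    and T: "T = (n * (13 * n + 6) + 1) + ((4 * (n * n) + 1) + (1 + ((4 * n + 1) +
      (poly q L + ((11 * (n * Suc n) + 1) +
        ((4 * (n * Suc (Suc n)) + 1) + (N * (2 * (L + poly q L) + 1) + 1)))))))"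
  shows "\<exists>S\<subseteq>X. independent_set G S \<and>
    (\<forall>Y. independent_set G Y \<longrightarrow> real (card (X \<inter> Y)) / \<rho> \<le> real (card S)) \<and>
    runs (greedy_round A N) (loop_state M (map (\<lambda>v. v \<in> X) [0..<n]) (rev (unary_list \<phi> [0..<n])) K) T
      (loop_state M (map (\<lambda>v. v \<in> X - S) [0..<n])
        (rev (unary_list (\<lambda>v. if v \<in> X - S then Suc (\<phi> v) else \<phi> v) [0..<n])) K)"
proof -
  define xs where "xs = rev (filter (\<lambda>v. v \<in> X) [0..<n])"
  have xs: "set xs = X" "distinct xs"
    using X by (auto simp: xs_def)
  let ?H = "relabelled_subgraph G xs"
  have len: "length xs \<le> n"
    using length_filter_le[of "\<lambda>v. v \<in> X" "[0..<n]"] by (simp add: xs_def)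
  obtain t S where S: "independent_set ?H S" "real (independence_number ?H) / \<rho> \<le> real (card S)"
    and run: "computes_in A (encode_graph ?H) t (encode_vertex_set ?H S)"
    and t: "t \<le> poly q (length (encode_graph ?H))"
    using A[OF relabelled_subgraph_instance[OF G]] by blast
  let ?S = "(!) xs ` S"
  have S_less: "i < length xs" if "i \<in> S" for i
    using S(1) that by (auto simp: independent_set_def relabelled_subgraph_def)
  have inj: "inj_on ((!) xs) {..<length xs}"
    using xs(2) by (simp add: inj_on_def nth_eq_iff_index_eq)
  have card_S: "card ?S = card S"
    using S_less by (intro card_image inj_on_subset[OF inj]) auto
  have mem: "xs ! i \<in> ?S \<longleftrightarrow> i \<in> S" if "i < length xs" for i
    using that S_less inj_on_image_mem_iff[OF inj, of i S] by auto
  \<comment> \<open>The output bits are indexed by positions; by injectivity they are the membership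
    bits of the vertices in the order of \<open>xs\<close>.\<close>
  have enc: "encode_vertex_set ?H S = map (\<lambda>v. v \<in> ?S) xs"
    using mem by (intro nth_equalityI) (auto simp: encode_vertex_set_def relabelled_subgraph_def)
  have "length (encode_graph ?H) = length xs * length xs + length xs + 1"
    by (simp add: encode_relabelled_subgraph length_concat comp_def sum_list_triv)
  also have "\<dots> \<le> L"
    unfolding L using len by (intro add_mono mult_le_mono) auto
  finally have lenH: "length (encode_graph ?H) \<le> L" .
  have "runs (greedy_round A N) (loop_state M (map (\<lambda>v. v \<in> X) [0..<n]) (rev (unary_list \<phi> [0..<n])) K) T
      (loop_state M (map (\<lambda>v. v \<in> X - ?S) [0..<n])
        (rev (unary_list (\<lambda>v. if v \<in> X - ?S then Suc (\<phi> v) else \<phi> v) [0..<n])) K)"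
    unfolding M
  proof (rule runs_greedy_round[OF _ N])
    show "computes_in A (replicate (length (rev (filter (\<lambda>v. v \<in> X) [0..<n]))) True @ [False] @
        concat (map (\<lambda>u. map (\<lambda>v. {u, v} \<in> edges G) (rev (filter (\<lambda>v. v \<in> X) [0..<n])))
          (rev (filter (\<lambda>v. v \<in> X) [0..<n])))) t (map (\<lambda>v. v \<in> ?S) (rev (filter (\<lambda>v. v \<in> X) [0..<n])))"
      using run unfolding enc encode_relabelled_subgraph unfolding xs_def .
    show "length (replicate (length (rev (filter (\<lambda>v. v \<in> X) [0..<n]))) True @ [False] @
        concat (map (\<lambda>u. map (\<lambda>v. {u, v} \<in> edges G) (rev (filter (\<lambda>v. v \<in> X) [0..<n])))
          (rev (filter (\<lambda>v. v \<in> X) [0..<n])))) \<le> L"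
      using lenH unfolding encode_relabelled_subgraph unfolding xs_def .
    \<comment> \<open>Natural coefficients make \<open>q\<close> monotone.\<close>
    show "t \<le> poly q L"
      using t poly_nat_mono[OF lenH] by (rule order_trans)
    show "\<phi> v \<le> n" if "v \<in> set [0..<n]" for v
      using \<phi>(1)[of v] \<phi>(2) that by auto
  qed (auto simp: T)
  moreover have "?S \<subseteq> X"
    using S_less xs(1) nth_mem by blast
  moreover have "independent_set G ?S"
    using S(1) X V xs(1) by (intro independent_set_relabelled_subgraph) auto
  moreover have "real (card (X \<inter> Y)) / \<rho> \<le> real (card ?S)" if "independent_set G Y" for Y
  proof -
    have "real (card (X \<inter> Y)) / \<rho> \<le> real (independence_number ?H) / \<rho>"
      using independence_number_relabelled_subgraph_ge[OF G xs(2) that] \<rho> xs(1)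
      by (intro divide_right_mono) auto
    then show ?thesis
      using S(2) card_S by simp
  qed
  ultimately show ?thesis
    by blast
qed

section \<open>Iterating the rounds\<close>

definition greedy_loop :: "com \<Rightarrow> nat \<Rightarrow> com" where
  "greedy_loop A N = While 8 (Seq (Pop 8) (greedy_round A N))"

text \<open>
  Before a round, \<open>X\<close> is the set of uncolored vertices and \<open>c\<close> is the next color. Uncolored
  vertices carry the color \<open>c\<close> provisionally; a round increases it on those that it does not pick.
\<close>

lemma runs_greedy_loop:
  fixes p \<rho> :: real
  assumes G: "simple_graph G" and V: "verts G = {..<n}" and p: "p > 0" and \<rho>: "\<rho> \<ge> 1"
    and round: "\<And>X \<phi> c K. X \<subseteq> {..<n} \<Longrightarrow> \<forall>v<n. \<phi> v \<le> c \<Longrightarrow> c \<le> n \<Longrightarrow>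
      \<exists>S\<subseteq>X. independent_set G S \<and>
      (\<forall>Y. independent_set G Y \<longrightarrow> real (card (X \<inter> Y)) / \<rho> \<le> real (card S)) \<and>
      runs (greedy_round A N) (loop_state M (map (\<lambda>v. v \<in> X) [0..<n]) (rev (unary_list \<phi> [0..<n])) K) T
        (loop_state M (map (\<lambda>v. v \<in> X - S) [0..<n])
          (rev (unary_list (\<lambda>v. if v \<in> X - S then Suc (\<phi> v) else \<phi> v) [0..<n])) K)"
    and "X \<subseteq> {..<n}" and "card X \<le> k" and "c + k \<le> n" and "\<And>v. v \<in> X \<Longrightarrow> \<phi> v = c"
    and "\<And>v. v < n \<Longrightarrow> \<phi> v \<le> c"
  shows "\<exists>\<phi>'. (\<forall>v. v \<notin> X \<longrightarrow> \<phi>' v = \<phi> v) \<and> (\<forall>v\<in>X. c \<le> \<phi>' v) \<and> (\<forall>v<n. \<phi>' v \<le> n) \<and>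
    (\<forall>u\<in>X. \<forall>v\<in>X. {u, v} \<in> edges G \<longrightarrow> \<phi>' u \<noteq> \<phi>' v) \<and>
    (\<forall>Y. independent_set G Y \<longrightarrow> (\<Sum>j=1..card (X \<inter> Y). (real j / \<rho>) powr p)
      \<le> (\<Sum>v\<in>X \<inter> Y. real (card {u \<in> X. \<phi>' u = \<phi>' v}) powr p)) \<and>
    runs (greedy_loop A N)
      (loop_state M (map (\<lambda>v. v \<in> X) [0..<n]) (rev (unary_list \<phi> [0..<n])) (replicate k True))
      (k * (T + 2) + 1)
      (loop_state M (replicate n False) (rev (unary_list \<phi>' [0..<n])) [])"
  using assms(6-)
proof (induction k arbitrary: X \<phi> c)
  case 0
  then have "X = {}"
    using finite_subset by fastforce
  moreover have "runs (greedy_loop A N) (loop_state M (replicate n False) C []) 1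
      (loop_state M (replicate n False) C [])" for C
    unfolding greedy_loop_def by (rule runs_While_Empty) (simp_all add: loop_state_def)
  moreover have "map (\<lambda>v. False) [0..<n] = replicate n False"
    by (simp add: map_replicate_const)
  moreover have "\<forall>v<n. \<phi> v \<le> n"
    using 0 order_trans by fastforce
  ultimately show ?case
    by (intro exI[of _ \<phi>]) (simp del: One_nat_def)
next
  case (Suc k)
  have finX: "finite X"
    using Suc.prems(1) finite_subset by blast
  have "c \<le> n" and "\<forall>v<n. \<phi> v \<le> c"
    using Suc.prems(3,5) by simp_all
  obtain S where SX: "S \<subseteq> X" and S: "independent_set G S"
    "\<forall>Y. independent_set G Y \<longrightarrow> real (card (X \<inter> Y)) / \<rho> \<le> real (card S)"
    and body: "runs (greedy_round A N)
      (loop_state M (map (\<lambda>v. v \<in> X) [0..<n]) (rev (unary_list \<phi> [0..<n])) (replicate k True)) T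
      (loop_state M (map (\<lambda>v. v \<in> X - S) [0..<n])
        (rev (unary_list (\<lambda>v. if v \<in> X - S then Suc (\<phi> v) else \<phi> v) [0..<n])) (replicate k True))"
    using round[OF Suc.prems(1) \<open>\<forall>v<n. \<phi> v \<le> c\<close> \<open>c \<le> n\<close>, where K = "replicate k True"]
    by (elim exE conjE) (rule that)
  note S = S(1) S(2)[rule_format]
  let ?\<phi> = "\<lambda>v. if v \<in> X - S then Suc (\<phi> v) else \<phi> v"
  \<comment> \<open>Progress: a single vertex is independent, so \<open>S\<close> is nonempty as
    long as \<open>X\<close> is, and \<open>k\<close> further rounds suffice for the rest.\<close>
  have card: "card (X - S) \<le> k"
  proof (cases "X = {}")
    case False
    then obtain v where v: "v \<in> X"
      by blast
    have "independent_set G {v}"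
      using G v V Suc.prems(1) by (auto simp: independent_set_def simple_graph_def)
    from S(2)[OF this] have "1 / \<rho> \<le> real (card S)"
      using v by simp
    moreover have "1 / \<rho> > 0"
      using \<rho> by simp
    ultimately have "card S > 0"
      by linarith
    then have "card (X - S) < card X"
      using SX finX card_mono[OF finX SX] by (simp add: card_Diff_subset finite_subset)
    then show ?thesis
      using Suc.prems(2) by simp
  qed simp
  have "\<exists>\<phi>'. (\<forall>v. v \<notin> X - S \<longrightarrow> \<phi>' v = ?\<phi> v) \<and> (\<forall>v\<in>X - S. Suc c \<le> \<phi>' v) \<and> (\<forall>v<n. \<phi>' v \<le> n) \<and>
    (\<forall>u\<in>X - S. \<forall>v\<in>X - S. {u, v} \<in> edges G \<longrightarrow> \<phi>' u \<noteq> \<phi>' v) \<and>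
    (\<forall>Y. independent_set G Y \<longrightarrow> (\<Sum>j=1..card ((X - S) \<inter> Y). (real j / \<rho>) powr p)
      \<le> (\<Sum>v\<in>(X - S) \<inter> Y. real (card {u \<in> X - S. \<phi>' u = \<phi>' v}) powr p)) \<and>
    runs (greedy_loop A N)
      (loop_state M (map (\<lambda>v. v \<in> X - S) [0..<n]) (rev (unary_list ?\<phi> [0..<n])) (replicate k True))
      (k * (T + 2) + 1)
      (loop_state M (replicate n False) (rev (unary_list \<phi>' [0..<n])) [])"
    by (rule Suc.IH) (use Suc.prems card in \<open>auto intro: le_SucI\<close>)
  then obtain \<phi>' where \<phi>': "\<forall>v. v \<notin> X - S \<longrightarrow> \<phi>' v = ?\<phi> v" "\<forall>v\<in>X - S. Suc c \<le> \<phi>' v"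
    "\<forall>v<n. \<phi>' v \<le> n"
    and proper: "\<forall>u\<in>X - S. \<forall>v\<in>X - S. {u, v} \<in> edges G \<longrightarrow> \<phi>' u \<noteq> \<phi>' v"
    and approx: "\<forall>Y. independent_set G Y \<longrightarrow> (\<Sum>j=1..card ((X - S) \<inter> Y). (real j / \<rho>) powr p)
      \<le> (\<Sum>v\<in>(X - S) \<inter> Y. real (card {u \<in> X - S. \<phi>' u = \<phi>' v}) powr p)"
    and loop: "runs (greedy_loop A N)
      (loop_state M (map (\<lambda>v. v \<in> X - S) [0..<n]) (rev (unary_list ?\<phi> [0..<n])) (replicate k True))
      (k * (T + 2) + 1)
      (loop_state M (replicate n False) (rev (unary_list \<phi>' [0..<n])) [])"
    by (elim exE conjE) (rule that)
  note \<phi>' = \<phi>'(1,2)[rule_format] \<phi>'(3) and proper = proper[rule_format] and approx = approx[rule_format]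
  \<comment> \<open>Picked vertices keep the color \<open>c\<close>, while all others in
    \<open>X\<close> end above \<open>c\<close>. So \<open>S\<close> is exactly one color class
    within \<open>X\<close>, and the later classes avoid it.\<close>
  have on_S: "\<phi>' v = c" if "v \<in> S" for v
    using \<phi>'(1)[of v] Suc.prems(4)[of v] SX that by auto
  have off_S: "\<phi>' v \<noteq> c" if "v \<in> X - S" for v
    using \<phi>'(2)[OF that] by simp
  have class_S: "{u \<in> X. \<phi>' u = \<phi>' v} = S" if "v \<in> S" for v
    using on_S off_S SX that by auto
  have class_rest: "{u \<in> X. \<phi>' u = \<phi>' v} = {u \<in> X - S. \<phi>' u = \<phi>' v}" if "v \<in> X - S" for v
    using on_S off_S[OF that] by fastforce
  have 1: "\<phi>' v = \<phi> v" if "v \<notin> X" for v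
    using \<phi>'(1)[of v] that by simp
  have 2: "c \<le> \<phi>' v" if "v \<in> X" for v
    using on_S[of v] \<phi>'(2)[of v] that by (cases "v \<in> S") auto
  have 3: "\<phi>' u \<noteq> \<phi>' v" if "u \<in> X" "v \<in> X" "{u, v} \<in> edges G" for u v
    using that S(1) proper[of u v] on_S off_S unfolding independent_set_def
    by (metis DiffI)
  have 4: "(\<Sum>j=1..card (X \<inter> Y). (real j / \<rho>) powr p)
      \<le> (\<Sum>v\<in>X \<inter> Y. real (card {u \<in> X. \<phi>' u = \<phi>' v}) powr p)" if "independent_set G Y" for Y
  proof (rule greedy_step[OF p \<rho> finX SX])
    show "real (card (X \<inter> Y)) / \<rho> \<le> real (card S)"
      by (rule S(2)[OF that])
    show "real (card {u \<in> X. \<phi>' u = \<phi>' v}) = real (card S)" if "v \<in> S" for v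
      using class_S[OF that] by simp
    show "(\<Sum>j=1..card ((X - S) \<inter> Y). (real j / \<rho>) powr p)
        \<le> (\<Sum>v\<in>(X - S) \<inter> Y. real (card {u \<in> X. \<phi>' u = \<phi>' v}) powr p)"
    proof -
      have "(\<Sum>v\<in>(X - S) \<inter> Y. real (card {u \<in> X. \<phi>' u = \<phi>' v}) powr p)
          = (\<Sum>v\<in>(X - S) \<inter> Y. real (card {u \<in> X - S. \<phi>' u = \<phi>' v}) powr p)"
        by (rule sum.cong[OF refl]) (use class_rest in simp)
      with approx[OF that] show ?thesis
        by (simp only:)
    qed
  qed
  have pop: "runs (Pop 8)
      (loop_state M (map (\<lambda>v. v \<in> X) [0..<n]) (rev (unary_list \<phi> [0..<n])) (replicate (Suc k) True)) 1
      (loop_state M (map (\<lambda>v. v \<in> X) [0..<n]) (rev (unary_list \<phi> [0..<n])) (replicate k True))"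
    (is "runs _ ?s _ ?s'")
  proof -
    have "?s(8 := tl (?s 8)) = ?s'"
      by (auto simp: loop_state_def)
    then show ?thesis
      unfolding runs_def using exec.Pop[of 8 ?s] by auto
  qed
  have 5: "runs (greedy_loop A N) ?s (Suc k * (T + 2) + 1)
      (loop_state M (replicate n False) (rev (unary_list \<phi>' [0..<n])) [])"
    unfolding greedy_loop_def
    by (rule runs_While_Nonempty[OF _ runs_Seq[OF pop body order_refl] loop[unfolded greedy_loop_def]])
      (simp_all add: loop_state_def)
  show ?case
    using 1 2 \<phi>'(3) 3 4 5 by blast
qed

section \<open>The complete program and its running time\<close>

definition greedy_coloring_program :: "com \<Rightarrow> nat \<Rightarrow> com" where
  "greedy_coloring_program A N = Seq (Push 7 True) (Seq (While 7 parse) (Seq (greedy_loop A N)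
    (Seq (While 0 (Pop 0)) (move 9 0))))"

text \<open>The colors are stored reversed, so moving them to register 0 yields the output order.
  The matrix is removed first, as it would remain beneath them.\<close>

lemma computes_greedy_coloring:
  assumes "x = replicate n True @ False # M"
    and loop: "runs (greedy_loop A N) (loop_state M (replicate n True)
      (rev (unary_list (\<lambda>_. 0) [0..<n])) (replicate n True)) T
      (loop_state M (replicate n False) (rev y) [])"
    and M: "length M = n * n" and y: "length y \<le> n * Suc n"
  shows "\<exists>t. computes_in (greedy_coloring_program A N) x t y \<and>
    t \<le> 1 + ((7 * n + 8) + (T + ((2 * (n * n) + 1) + (4 * (n * Suc n) + 1))))"
proof -
  let ?s0 = "(\<lambda>r. if r = 0 then x else []) :: state"
  let ?s1 = "?s0(7 := True # ?s0 7)"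
  let ?s2 = "loop_state M (replicate n True) (rev (unary_list (\<lambda>_. 0) [0..<n])) (replicate n True)"
  let ?s3 = "loop_state M (replicate n False) (rev y) []"
  let ?s4 = "?s3(0 := [])"
  let ?s5 = "?s4(9 := [], 0 := rev (?s4 9) @ ?s4 0)"
  have 1: "runs (Push 7 True) ?s0 1 ?s1"
    unfolding runs_def by (blast intro: exec.Push)
  \<comment> \<open>The color 0 consists of its terminator alone, so the list is what
    \<open>parse\<close> has pushed on register 9.\<close>
  have C: "rev (unary_list (\<lambda>_. 0) [0..<n]) = replicate n False"
    by (simp add: rev_unary_list map_replicate_const flip: concat_replicate_trivial)
  have 2: "runs (While 7 parse) ?s1 (7 * n + 8) ?s2"
  proof -
    have "runs (While 7 parse) ?s1 (7 * n + 8) (?s1(0 := M, 1 := replicate n True @ ?s1 1,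
      2 := replicate n True @ ?s1 2, 7 := [], 8 := replicate n True @ ?s1 8,
      9 := replicate n False @ ?s1 9))"
      by (rule runs_parse) (simp_all add: assms(1))
    moreover have "?s1(0 := M, 1 := replicate n True @ ?s1 1,
      2 := replicate n True @ ?s1 2, 7 := [], 8 := replicate n True @ ?s1 8,
      9 := replicate n False @ ?s1 9) = ?s2"
      by (auto simp: loop_state_def C)
    ultimately show ?thesis
      by (simp only:)
  qed
  have 4: "runs (While 0 (Pop 0)) ?s3 (2 * (n * n) + 1) ?s4"
    by (rule runs_While_Pop) (simp add: loop_state_def M)
  have 5: "runs (move 9 0) ?s4 (4 * (n * Suc n) + 1) ?s5"
    by (rule runs_move) (use y in \<open>simp_all add: loop_state_def\<close>)
  note seq = runs_Seq[OF _ _ order_refl]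
  have "runs (greedy_coloring_program A N) ?s0
      (1 + ((7 * n + 8) + (T + ((2 * (n * n) + 1) + (4 * (n * Suc n) + 1))))) ?s5"
    unfolding greedy_coloring_program_def
    by (rule seq[OF 1 seq[OF 2 seq[OF loop seq[OF 4 5]]]])
  moreover have "?s5 0 = y"
    by (simp add: loop_state_def)
  ultimately show ?thesis
    unfolding runs_def computes_in_def by blast
qed

theorem theorem5:
  fixes p \<rho> :: real
  assumes "p > 0" and "\<rho> \<ge> 1"
    and "\<exists>A. polynomial_time_algorithm graph_instances encode_graph encode_vertex_set
           (\<lambda>G S. independent_set G S \<and> real (card S) \<ge> real (independence_number G) / \<rho>) A"
  shows "\<exists>B. polynomial_time_algorithm graph_instances encode_graph encode_coloring
           (\<lambda>G \<phi>. proper_coloring G \<phi> \<and>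
              coloring_value p G \<phi> \<ge> OPT p G / (\<rho> * (p + 1) powr (1 / p))) B"
proof -
  obtain A and q :: "nat poly" where A: "\<And>H. H \<in> graph_instances \<Longrightarrow> \<exists>t S.
      (independent_set H S \<and> real (card S) \<ge> real (independence_number H) / \<rho>) \<and>
      computes_in A (encode_graph H) t (encode_vertex_set H S) \<and> t \<le> poly q (length (encode_graph H))"
    using assms(3) unfolding polynomial_time_algorithm_def by metis
  obtain N0 where "registers A \<subseteq> {..<N0}"
    using finite_registers finite_nat_iff_bounded by blast
  then obtain N where N: "registers A \<subseteq> {..<N}" "0 < N"
    by (intro that[of "Suc N0"]) auto
  \<comment> \<open>\<open>X\<close> is the identity polynomial. \<open>R\<close> and
    \<open>Q\<close> bound one round and the whole program in terms of the number of vertices;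
    \<open>pcompose q L\<close> accounts for the given program.\<close>
  define X :: "nat poly" where "X = [:0, 1:]"
  define L where "L = X * X + X + 1"
  define R where "R = ([:13:] * X * X + [:6:] * X + 1) + (([:4:] * X * X + 1) + (1 + (([:4:] * X + 1) +
      (pcompose q L + (([:11:] * X * (X + 1) + 1) + (([:4:] * X * (X + 1 + 1) + 1) +
        ([:N:] * ([:2:] * (L + pcompose q L) + 1) + 1)))))))"
  define Q where "Q = 1 + (([:7:] * X + [:8:]) + (X * (R + [:2:]) + 1 +
      (([:2:] * X * X + 1) + ([:4:] * X * (X + 1) + 1))))"
  have "\<exists>t \<phi>. (proper_coloring G \<phi> \<and> coloring_value p G \<phi> \<ge> OPT p G / (\<rho> * (p + 1) powr (1 / p))) \<and>
      computes_in (greedy_coloring_program A N) (encode_graph G) t (encode_coloring G \<phi>) \<and>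
      t \<le> poly Q (length (encode_graph G))" if inst: "G \<in> graph_instances" for G
  proof -
    obtain n where G: "simple_graph G" and V: "verts G = {..<n}"
      using inst by (auto simp: graph_instances_def)
    define M where "M = concat (map (\<lambda>u. map (\<lambda>v. {u, v} \<in> edges G) [0..<n]) [0..<n])"
    have M: "length M = n * n"
      by (simp add: M_def length_concat comp_def sum_list_triv)
    have enc: "encode_graph G = replicate n True @ False # M"
      by (simp add: encode_graph_def V M_def)
    note round = runs_greedy_round_graph[OF G V A assms(2) N _ _ _ refl M_def refl]
    let ?T = "poly R n"
    \<comment> \<open>Initially all \<open>n\<close> vertices are uncolored with provisional color
      0. There are \<open>n\<close> rounds, enough even if each picks a single vertex.\<close>
    have "\<exists>\<phi>. (\<forall>v. v \<notin> {..<n} \<longrightarrow> \<phi> v = 0) \<and> (\<forall>v\<in>{..<n}. 0 \<le> \<phi> v) \<and> (\<forall>v<n. \<phi> v \<le> n) \<and>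
      (\<forall>u\<in>{..<n}. \<forall>v\<in>{..<n}. {u, v} \<in> edges G \<longrightarrow> \<phi> u \<noteq> \<phi> v) \<and>
      (\<forall>Y. independent_set G Y \<longrightarrow> (\<Sum>j=1..card ({..<n} \<inter> Y). (real j / \<rho>) powr p)
        \<le> (\<Sum>v\<in>{..<n} \<inter> Y. real (card {u \<in> {..<n}. \<phi> u = \<phi> v}) powr p)) \<and>
      runs (greedy_loop A N)
        (loop_state M (map (\<lambda>v. v \<in> {..<n}) [0..<n]) (rev (unary_list (\<lambda>_. 0) [0..<n])) (replicate n True))
        (n * (?T + 2) + 1)
        (loop_state M (replicate n False) (rev (unary_list \<phi> [0..<n])) [])"
    proof (rule runs_greedy_loop[OF G V assms(1,2)])
      fix X' :: "nat set" and \<phi> c K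
      assume "X' \<subseteq> {..<n}" "\<forall>v<n. \<phi> v \<le> c" "c \<le> n"
      moreover have "(n * (13 * n + 6) + 1) + ((4 * (n * n) + 1) + (1 + ((4 * n + 1) +
        (poly q (n * n + n + 1) + ((11 * (n * Suc n) + 1) +
        ((4 * (n * Suc (Suc n)) + 1) + (N * (2 * ((n * n + n + 1) + poly q (n * n + n + 1)) + 1) + 1)))))))
        = ?T"
        by (simp add: R_def L_def X_def poly_pcompose algebra_simps)
      ultimately show "\<exists>S\<subseteq>X'. independent_set G S \<and>
        (\<forall>Y. independent_set G Y \<longrightarrow> real (card (X' \<inter> Y)) / \<rho> \<le> real (card S)) \<and>
        runs (greedy_round A N) (loop_state M (map (\<lambda>v. v \<in> X') [0..<n]) (rev (unary_list \<phi> [0..<n])) K) ?T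
        (loop_state M (map (\<lambda>v. v \<in> X' - S) [0..<n])
          (rev (unary_list (\<lambda>v. if v \<in> X' - S then Suc (\<phi> v) else \<phi> v) [0..<n])) K)"
        using round[of X' \<phi> c K] by presburger
    qed auto
    then obtain \<phi> where \<phi>: "\<forall>v<n. \<phi> v \<le> n"
      and proper: "\<forall>u\<in>{..<n}. \<forall>v\<in>{..<n}. {u, v} \<in> edges G \<longrightarrow> \<phi> u \<noteq> \<phi> v"
      and approx: "\<forall>Y. independent_set G Y \<longrightarrow> (\<Sum>j=1..card ({..<n} \<inter> Y). (real j / \<rho>) powr p)
        \<le> (\<Sum>v\<in>{..<n} \<inter> Y. real (card {u \<in> {..<n}. \<phi> u = \<phi> v}) powr p)"
      and loop: "runs (greedy_loop A N)
        (loop_state M (map (\<lambda>v. v \<in> {..<n}) [0..<n]) (rev (unary_list (\<lambda>_. 0) [0..<n])) (replicate n True))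
        (n * (?T + 2) + 1)
        (loop_state M (replicate n False) (rev (unary_list \<phi> [0..<n])) [])"
      by (elim exE conjE) (rule that)
    have "proper_coloring G \<phi>"
      unfolding proper_coloring_def
    proof (intro allI impI)
      fix u v assume e: "{u, v} \<in> edges G"
      then have "{u, v} \<subseteq> {..<n}"
        using G V unfolding simple_graph_def by metis
      then show "\<phi> u \<noteq> \<phi> v"
        using proper e by simp
    qed
    moreover have "OPT p G / (\<rho> * (p + 1) powr (1 / p)) \<le> coloring_value p G \<phi>"
    proof (rule OPT_approx[OF assms(1,2) G])
      fix Y assume Y: "independent_set G Y"
      then have "{..<n} \<inter> Y = Y"
        using V by (auto simp: independent_set_def)
      then show "(\<Sum>j=1..card Y. (real j / \<rho>) powr p)
          \<le> (\<Sum>v\<in>Y. real (color_class_size G \<phi> v) powr p)"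
        using approx[rule_format, OF Y] by (simp add: color_class_size_def V)
    qed
    moreover have "map (\<lambda>v. v \<in> {..<n}) [0..<n] = replicate n True"
      by (intro nth_equalityI) auto
    then have "\<exists>t. computes_in (greedy_coloring_program A N) (encode_graph G) t (unary_list \<phi> [0..<n]) \<and>
      t \<le> 1 + ((7 * n + 8) + ((n * (?T + 2) + 1) + ((2 * (n * n) + 1) + (4 * (n * Suc n) + 1))))"
      using computes_greedy_coloring[OF enc _ M, of A N "n * (?T + 2) + 1" "unary_list \<phi> [0..<n]"]
        loop length_unary_list_le[of "[0..<n]" \<phi> n] \<phi> by simp
    then obtain t where "computes_in (greedy_coloring_program A N) (encode_graph G) t (encode_coloring G \<phi>)"
      and t: "t \<le> 1 + ((7 * n + 8) + ((n * (?T + 2) + 1) + ((2 * (n * n) + 1) + (4 * (n * Suc n) + 1))))"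
      by (auto simp: unary_list_def encode_coloring_def V)
    moreover have "t \<le> poly Q (length (encode_graph G))"
    proof -
      have "1 + ((7 * n + 8) + ((n * (?T + 2) + 1) + ((2 * (n * n) + 1) + (4 * (n * Suc n) + 1)))) = poly Q n"
        by (simp add: Q_def X_def algebra_simps)
      \<comment> \<open>The header alone has \<open>n\<close> bits, so \<open>n\<close> is at most
        the input length.\<close>
      also have "\<dots> \<le> poly Q (length (encode_graph G))"
        by (rule poly_nat_mono) (simp add: enc)
      finally show ?thesis
        using t by simp
    qed
    ultimately show ?thesis
      by blast
  qed
  then show ?thesis
    unfolding polynomial_time_algorithm_def by blast
qed

end
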